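(* Let $p$ be a prime, $k$ a perfect field of characteristic $p$ and $m$ a positive integer. Let $T'_1:\Gamma^p_{\mathbb Z}(\mathbf W_m(k))\to\mathbf W_{m+1}(k)$ be the natural surjective group homomorphism characterized by $[x]_p\mapsto X^p$, where $X\in\mathbf W_{m+1}(k)$ is any lift of $x\in\mathbf W_m(k)$. Then the kernel of $T'_1$ is generated, as an abelian group, by the elements $$[x]_1[y]_{p-1}-[xy^{p-1}]_1[1]_{p-1},\qquad x,y\in\mathbf W_m(k).$$
   Context: $\mathbf W(k)$ is the ring of $p$-typical Witt vectors of $k$ and $\mathbf W_j(k)=\mathbf W(k)/p^j$. For a commutative ring $A$ and an $A$-module $M$, $\Gamma_A(M)=\bigoplus_j\Gamma_A^j(M)$ is the divided power algebra, generated by degree $i$ symbols $[x]_i$ ($x\in M$, $i\ge0$) subject to $[x]_0=1$, $[x+x']_n=\sum_{i=0}^n[x]_i[x']_{n-i}$, $[\lambda x]_n=\lambda^n[x]_n$, $[x]_n[x]_m=\binom{n+m}{n}[x]_{n+m}$. Homomorphisms $\Gamma^j_A(M)\to N$ of $A$-modules correspond to polynomial laws $M\to N$ over $A$ (natural transformations $M\otimes_AR\to N\otimes_AR$ in commutative $A$-algebras $R$), homogeneous of degree $j$, via $[x]_j\mapsto$ value at $x$. Here $\Gamma^p_{\mathbb Z}(\mathbf W_m(k))$ is formed from the abelian group $\mathbf W_m(k)$ over $A=\mathbb Z$, and $T'_1$ corresponds to the polynomial law over $\mathbb Z$, homogeneous of degree $p$, given by $x\mapsto X^p$ for any lift $X$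 of $x$ (applied functorially after tensoring with any commutative ring); it is well defined because $(X+p^mY)^p\equiv X^p$ mod $p^{m+1}$. *)

theory Defs
  imports
    "HOL-Computational_Algebra.Primes"
    "HOL-Library.Poly_Mapping"
    "HOL-Algebra.QuotRing"
    "HOL-Algebra.Generated_Groups"
begin

section \<open>Integer polynomials in arbitrary sets of variables\<close>

text \<open>Monomials are finitely supported exponent functions.\<close>

type_synonym 'v int_poly = "('v \<Rightarrow>\<^sub>0 nat) \<Rightarrow>\<^sub>0 int"

definition poly_var :: "'v \<Rightarrow> 'v int_poly" where
  "poly_var v = Poly_Mapping.single (Poly_Mapping.single v 1) 1"

definition poly_eval :: "('v \<Rightarrow> 'a::comm_ring_1) \<Rightarrow> 'v int_poly \<Rightarrow> 'a" where
  "poly_eval f P = (\<Sum>\<mu>\<in>Poly_Mapping.keys P.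
     of_int (Poly_Mapping.lookup P \<mu>) *
       (\<Prod>v\<in>Poly_Mapping.keys \<mu>. f v ^ Poly_Mapping.lookup \<mu> v))"


section \<open>\<open>p\<close>-typical Witt vectors\<close>

definition ghost :: "nat \<Rightarrow> (nat \<Rightarrow> 'a::comm_ring_1) \<Rightarrow> nat \<Rightarrow> 'a" where
  "ghost p a n = (\<Sum>i\<le>n. of_nat p ^ i * a i ^ (p ^ (n - i)))"

text \<open>
  The universal polynomials of the Witt vector addition (\<open>f\<close> is \<open>+\<close>) and multiplication
  (\<open>f\<close> is \<open>*\<close>): by Witt's theorem, for \<open>p\<close> prime there is exactly one sequence of integer
  polynomials in the variables \<open>X\<^sub>i\<close> (encoded as \<open>Inl i\<close>) and \<open>Y\<^sub>i\<close> (encoded as \<open>Inr i\<close>)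
  whose ghost components are obtained by applying \<open>f\<close> to those of \<open>X\<close> and \<open>Y\<close>.
\<close>

definition witt_polys ::
  "nat \<Rightarrow> ((nat + nat) int_poly \<Rightarrow> (nat + nat) int_poly \<Rightarrow> (nat + nat) int_poly)
     \<Rightarrow> nat \<Rightarrow> (nat + nat) int_poly" where
  "witt_polys p f = (THE s. \<forall>n. ghost p s n =
     f (ghost p (\<lambda>i. poly_var (Inl i)) n) (ghost p (\<lambda>i. poly_var (Inr i)) n))"

definition witt_ring :: "nat \<Rightarrow> (nat \<Rightarrow> 'a::comm_ring_1) ring" where
  "witt_ring p =
     \<lparr>carrier = UNIV,
      mult = (\<lambda>a b n. poly_eval (case_sum a b) (witt_polys p (\<lambda>P Q. P * Q) n)),
      one = (\<lambda>n. if n = 0 then 1 else 0),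
      zero = (\<lambda>n. 0),
      add = (\<lambda>a b n. poly_eval (case_sum a b) (witt_polys p (\<lambda>P Q. P + Q) n))\<rparr>"

definition witt_ideal :: "nat \<Rightarrow> nat \<Rightarrow> (nat \<Rightarrow> 'a::comm_ring_1) set" where
  "witt_ideal p j = PIdl\<^bsub>witt_ring p\<^esub> ([(p ^ j)] \<cdot>\<^bsub>witt_ring p\<^esub> \<one>\<^bsub>witt_ring p\<^esub>)"

definition witt_quot :: "nat \<Rightarrow> nat \<Rightarrow> (nat \<Rightarrow> 'a::comm_ring_1) set ring" where
  "witt_quot p j = witt_ring p Quot witt_ideal p j"

text \<open>\<open>X \<in> W/p\<^sup>i\<close> lifts \<open>x \<in> W/p\<^sup>j\<close> (meant for \<open>i \<ge> j\<close>) if both are classes of one Witt vector.\<close>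

definition witt_lifts ::
  "nat \<Rightarrow> nat \<Rightarrow> nat \<Rightarrow> (nat \<Rightarrow> 'a::comm_ring_1) set \<Rightarrow> (nat \<Rightarrow> 'a) set \<Rightarrow> bool" where
  "witt_lifts p i j X x \<longleftrightarrow>
     (\<exists>a\<in>carrier (witt_ring p).
        X = witt_ideal p i +>\<^bsub>witt_ring p\<^esub> a \<and> x = witt_ideal p j +>\<^bsub>witt_ring p\<^esub> a)"


section \<open>The divided power algebra over the integers\<close>

text \<open>
  Only the additive group underlying \<open>M\<close> is used. The variable \<open>(x, i)\<close> stands for the
  symbol \<open>[x]\<^sub>i\<close>; it has weight \<open>i\<close>.
\<close>

definition dp_poly_ring :: "('m, 'c) ring_scheme \<Rightarrow> ('m \<times> nat) int_poly ring" where
  "dp_poly_ring M =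
     \<lparr>carrier = {P. \<forall>\<mu>\<in>Poly_Mapping.keys P. \<forall>v\<in>Poly_Mapping.keys \<mu>. fst v \<in> carrier M},
      mult = (\<lambda>P Q. P * Q), one = 1, zero = 0, add = (\<lambda>P Q. P + Q)\<rparr>"

definition dp_relations :: "('m, 'c) ring_scheme \<Rightarrow> ('m \<times> nat) int_poly set" where
  "dp_relations M =
     {poly_var (x, 0) - 1 | x. x \<in> carrier M} \<union>
     {poly_var (x \<oplus>\<^bsub>M\<^esub> y, n) - (\<Sum>i\<le>n. poly_var (x, i) * poly_var (y, n - i)) | x y n.
        x \<in> carrier M \<and> y \<in> carrier M} \<union>
     {poly_var ([l] \<cdot>\<^bsub>M\<^esub> x, n) - of_int (l ^ n) * poly_var (x, n) | (l::int) x n.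
        x \<in> carrier M} \<union>
     {poly_var (x, n) * poly_var (x, k) - of_nat ((n + k) choose n) * poly_var (x, n + k) | x n k.
        x \<in> carrier M}"

definition dp_ideal :: "('m, 'c) ring_scheme \<Rightarrow> ('m \<times> nat) int_poly set" where
  "dp_ideal M = Idl\<^bsub>dp_poly_ring M\<^esub> (dp_relations M)"

definition dp_algebra :: "('m, 'c) ring_scheme \<Rightarrow> ('m \<times> nat) int_poly set ring" where
  "dp_algebra M = dp_poly_ring M Quot dp_ideal M"

definition dp_symbol :: "('m, 'c) ring_scheme \<Rightarrow> 'm \<Rightarrow> nat \<Rightarrow> ('m \<times> nat) int_poly set" where
  "dp_symbol M x i = dp_ideal M +>\<^bsub>dp_poly_ring M\<^esub> poly_var (x, i)"

definition dp_weight :: "('m \<times> nat \<Rightarrow>\<^sub>0 nat) \<Rightarrow> nat" where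
  "dp_weight \<mu> = (\<Sum>v\<in>Poly_Mapping.keys \<mu>. Poly_Mapping.lookup \<mu> v * snd v)"

text \<open>The degree \<open>j\<close> component, as an abelian group written multiplicatively as usual
  in \<open>HOL-Algebra\<close>.\<close>

definition dp_component :: "('m, 'c) ring_scheme \<Rightarrow> nat \<Rightarrow> ('m \<times> nat) int_poly set monoid" where
  "dp_component M j =
     \<lparr>carrier = {dp_ideal M +>\<^bsub>dp_poly_ring M\<^esub> P | P.
        P \<in> carrier (dp_poly_ring M) \<and> (\<forall>\<mu>\<in>Poly_Mapping.keys P. dp_weight \<mu> = j)},
      mult = add (dp_algebra M),
      one = zero (dp_algebra M)\<rparr>"


section \<open>The power map\<close>

text \<open>
  For \<open>k\<close> perfect of characteristic \<open>p\<close> and \<open>m > 0\<close> the symbols \<open>[x]\<^sub>p\<close> generate the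
  degree \<open>p\<close> component additively, so at most one homomorphism sends \<open>[x]\<^sub>p\<close> to \<open>X\<^sup>p\<close> for
  all lifts \<open>X\<close> of \<open>x\<close>; one exists because \<open>X \<mapsto> X\<^sup>p\<close> induces a polynomial law. The
  restriction to extensional functions makes it unique as a HOL function.
\<close>

definition is_power_map ::
  "nat \<Rightarrow> nat \<Rightarrow> (((nat \<Rightarrow> 'a::comm_ring_1) set \<times> nat) int_poly set \<Rightarrow> (nat \<Rightarrow> 'a) set) \<Rightarrow> bool" where
  "is_power_map p m T \<longleftrightarrow>
     T \<in> hom (dp_component (witt_quot p m) p) (add_monoid (witt_quot p (m + 1))) \<and>
     T \<in> extensional (carrier (dp_component (witt_quot p m) p)) \<and>
     (\<forall>x\<in>carrier (witt_quot p m). \<forall>X\<in>carrier (witt_quot p (m + 1)).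
        witt_lifts p (m + 1) m X x \<longrightarrow>
          T (dp_symbol (witt_quot p m) x p) = X [^]\<^bsub>witt_quot p (m + 1)\<^esub> p)"

definition power_map ::
  "nat \<Rightarrow> nat \<Rightarrow> ((nat \<Rightarrow> 'a::comm_ring_1) set \<times> nat) int_poly set \<Rightarrow> (nat \<Rightarrow> 'a) set" where
  "power_map p m = (THE T. is_power_map p m T)"

definition power_map_relations ::
  "nat \<Rightarrow> nat \<Rightarrow> ((nat \<Rightarrow> 'a::comm_ring_1) set \<times> nat) int_poly set set" where
  "power_map_relations p m =
     (let W = witt_quot p m; \<Gamma> = dp_algebra W in
      {(dp_symbol W x 1 \<otimes>\<^bsub>\<Gamma>\<^esub> dp_symbol W y (p - 1)) \<ominus>\<^bsub>\<Gamma>\<^esub>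
       (dp_symbol W (x \<otimes>\<^bsub>W\<^esub> (y [^]\<^bsub>W\<^esub> (p - 1))) 1 \<otimes>\<^bsub>\<Gamma>\<^esub> dp_symbol W \<one>\<^bsub>W\<^esub> (p - 1)) | x y.
       x \<in> carrier W \<and> y \<in> carrier W})"

end

theory Submission
  imports Defs "HOL-Computational_Algebra.Formal_Power_Series"
begin

text \<open>
  Write \<open>\<psi>(w) = [w]\<^sub>1[1]\<^sub>p\<^sub>-\<^sub>1\<close>, which the power map sends to \<open>p w\<close>. Modulo the given relations
  \<open>[x]\<^sub>1[y]\<^sub>p\<^sub>-\<^sub>1\<close> equals \<open>\<psi>(x y\<^sup>p\<^sup>-\<^sup>1)\<close>, so by polarization all products of \<open>p\<close> symbols of degree
  one lie in the image of \<open>\<psi>\<close>. As factorials below \<open>p!\<close> act invertibly on the \<open>p\<close>-power torsion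
  group \<open>\<Gamma>\<^sup>p\<close>, the same holds for all mixed monomials. Hence \<open>[x]\<^sub>p\<close> is additive in \<open>x\<close> modulo the image
  of \<open>\<psi>\<close>, and every element has the form \<open>[x]\<^sub>p + \<psi>(w)\<close> modulo the relations. If it is in the kernel,
  then \<open>x\<^sup>p\<close> and therefore \<open>x\<close> is divisible by \<open>p\<close>; since \<open>p [x']\<^sub>p = [x']\<^sub>1[x']\<^sub>p\<^sub>-\<^sub>1\<close>, also \<open>[p x']\<^sub>p\<close> is in the
  image of \<open>\<psi>\<close>, and \<open>p : W\<^sub>m \<rightarrow> W\<^sub>m\<^sub>+\<^sub>1\<close> is injective. Besides the ring axioms, the only properties of
  \<open>W(k)\<close> that enter are that \<open>p\<close> is not a zero divisor and that \<open>x \<mapsto> x\<^sup>p\<close> is bijective on \<open>W(k)/p\<close>.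
\<close>


section \<open>Evaluation of integer polynomials\<close>

text \<open>The Witt operations and the power map are both given by definite descriptions, so
  existence and uniqueness must be settled before the kernel can be discussed. For the Witt
  polynomials this is Dwork's criterion together with injectivity of the ghost map on integer
  polynomials. For the power map, uniqueness means that the symbols \<open>[x]_p\<close> span degree
  p. Existence meets an obstacle: lifts from W/p^m to W/p^(m+1) cannot be chosen additively, so
  sending \<open>[x]_i\<close> to the i-th divided power of X t respects the defining relations only
  up to replacing some a by a b congruent to it modulo p^m. The p-th coefficient does not see this
  error modulo p^(m+1), since p^(m+1) divides binom(p,n) (a^n - b^n). In weight p only the symbols
  \<open>[x]_p\<close> escape the products of degree one symbols, because p! is not invertible. The
  resulting two-term normal form mirrors the target: every Witt vector is some a^p + p b, the
  summands being values of \<open>[x]_p\<close> and of \<open>\<psi>\<close>.\<close>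

abbreviation monom_eval :: "('v \<Rightarrow> 'a::comm_ring_1) \<Rightarrow> ('v \<Rightarrow>\<^sub>0 nat) \<Rightarrow> 'a" where
  "monom_eval f \<mu> \<equiv> (\<Prod>v\<in>Poly_Mapping.keys \<mu>. f v ^ Poly_Mapping.lookup \<mu> v)"

lemma monom_eval_superset:
  assumes "finite S" "Poly_Mapping.keys \<mu> \<subseteq> S"
  shows "monom_eval f \<mu> = (\<Prod>v\<in>S. f v ^ Poly_Mapping.lookup \<mu> v)"
  using assms by (intro prod.mono_neutral_left) (auto simp: in_keys_iff)

lemma monom_eval_add: "monom_eval f (\<mu> + \<nu>) = monom_eval f \<mu> * monom_eval f \<nu>"
proof -
  obtain S where S: "finite S" "Poly_Mapping.keys (\<mu> + \<nu>) \<subseteq> S"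
      "Poly_Mapping.keys \<mu> \<subseteq> S" "Poly_Mapping.keys \<nu> \<subseteq> S"
    using Poly_Mapping.keys_add[of \<mu> \<nu>] by (meson finite_UnI finite_keys sup_ge1 sup_ge2)
  show ?thesis
    unfolding monom_eval_superset[OF S(1,2)] monom_eval_superset[OF S(1,3)] monom_eval_superset[OF S(1,4)]
    by (simp add: lookup_add power_add prod.distrib)
qed

lemma poly_eval_superset:
  assumes "finite S" "Poly_Mapping.keys P \<subseteq> S"
  shows "poly_eval f P = (\<Sum>\<mu>\<in>S. of_int (Poly_Mapping.lookup P \<mu>) * monom_eval f \<mu>)"
  unfolding poly_eval_def using assms by (intro sum.mono_neutral_left) (auto simp: in_keys_iff)

lemma poly_eval_zero [simp]: "poly_eval f 0 = 0"
  by (simp add: poly_eval_def)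

lemma poly_eval_diff [simp]: "poly_eval f (P - Q) = poly_eval f P - poly_eval f Q"
proof -
  obtain S where S: "finite S" "Poly_Mapping.keys (P - Q) \<subseteq> S"
      "Poly_Mapping.keys P \<subseteq> S" "Poly_Mapping.keys Q \<subseteq> S"
    using keys_diff[of P Q] by (meson finite_UnI finite_keys sup_ge1 sup_ge2)
  then show ?thesis
    by (simp add: poly_eval_superset[of S] lookup_minus left_diff_distrib sum_subtractf)
qed

lemma poly_eval_uminus [simp]: "poly_eval f (- P) = - poly_eval f P"
  using poly_eval_diff[of f 0 P] by simp

lemma poly_eval_add [simp]: "poly_eval f (P + Q) = poly_eval f P + poly_eval f Q"
  using poly_eval_diff[of f P "- Q"] by simp

lemma poly_eval_monom: "poly_eval f (Poly_Mapping.single \<mu> 1) = monom_eval f \<mu>"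
  by (simp add: poly_eval_def)

lemma poly_eval_one [simp]: "poly_eval f 1 = 1"
  using poly_eval_monom[of f 0] by simp

lemma poly_eval_var [simp]: "poly_eval f (poly_var v) = f v"
  by (simp add: poly_var_def poly_eval_monom)

lemma poly_eval_mult [simp]: "poly_eval f (P * Q) = poly_eval f P * poly_eval f Q"
\<comment> \<open>Additively, the integer polynomials are the free abelian group on the monomials,
  so biadditivity reduces the claim to two monomials.\<close>
proof (rule frag_induction[of P UNIV])
  fix \<mu>
  show "poly_eval f (frag_of \<mu> * Q) = poly_eval f (frag_of \<mu>) * poly_eval f Q"
    by (rule frag_induction[of Q UNIV])
      (auto simp: right_diff_distrib mult_single poly_eval_monom monom_eval_add)
qed (auto simp: left_diff_distrib)

lemma poly_eval_power [simp]: "poly_eval f (P ^ n) = poly_eval f P ^ n"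
  by (induction n) auto

lemma poly_eval_of_nat [simp]: "poly_eval f (of_nat n) = of_nat n"
  by (induction n) auto

lemma poly_eval_of_int [simp]: "poly_eval f (of_int n) = of_int n"
  by (cases n) auto

lemma poly_eval_sum [simp]: "poly_eval f (sum g A) = (\<Sum>x\<in>A. poly_eval f (g x))"
  by (induction A rule: infinite_finite_induct) auto

lemma single_sum_eq_prod:
  "Poly_Mapping.single (sum g A) (1::int) = (\<Prod>x\<in>A. Poly_Mapping.single (g x) 1)"
  for g :: "'x \<Rightarrow> 'v \<Rightarrow>\<^sub>0 nat"
proof (induction A rule: infinite_finite_induct)
  case (insert x F)
  then show ?case by (simp add: mult_single flip: insert.IH)
qed auto

lemma poly_var_power: "poly_var v ^ n = Poly_Mapping.single (Poly_Mapping.single v n) 1"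
  by (induction n) (auto simp: poly_var_def mult_single simp flip: single_add)

lemma poly_mapping_sum_single:
  "(\<Sum>v\<in>Poly_Mapping.keys \<mu>. Poly_Mapping.single v (Poly_Mapping.lookup \<mu> v)) = \<mu>"
  for \<mu> :: "'v \<Rightarrow>\<^sub>0 nat"
proof (rule poly_mapping_eqI)
  fix w
  have "(\<Sum>v\<in>Poly_Mapping.keys \<mu>. Poly_Mapping.lookup (Poly_Mapping.single v (Poly_Mapping.lookup \<mu> v)) w)
     = (\<Sum>v\<in>Poly_Mapping.keys \<mu>. if v = w then Poly_Mapping.lookup \<mu> w else 0)"
    by (rule sum.cong) (auto simp: lookup_single when_def)
  also have "\<dots> = Poly_Mapping.lookup \<mu> w"
    by (auto simp: in_keys_iff)
  finally show "Poly_Mapping.lookup (\<Sum>v\<in>Poly_Mapping.keys \<mu>. Poly_Mapping.single v (Poly_Mapping.lookup \<mu> v)) w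
      = Poly_Mapping.lookup \<mu> w"
    by (simp add: lookup_sum)
qed

lemma monom_eq_prod_vars: "Poly_Mapping.single \<mu> 1 = monom_eval poly_var \<mu>"
  using single_sum_eq_prod[of "\<lambda>v. Poly_Mapping.single v (Poly_Mapping.lookup \<mu> v)" "Poly_Mapping.keys \<mu>"]
  by (simp add: poly_mapping_sum_single poly_var_power)

lemma int_poly_induct [consumes 1, case_names one var diff mult]:
  fixes P :: "'v int_poly"
  assumes P: "\<And>\<mu>. \<mu> \<in> Poly_Mapping.keys P \<Longrightarrow> Poly_Mapping.keys \<mu> \<subseteq> V"
    and one: "Q 1" and var: "\<And>v. v \<in> V \<Longrightarrow> Q (poly_var v)"
    and diff: "\<And>A B. Q A \<Longrightarrow> Q B \<Longrightarrow> Q (A - B)"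
    and mult: "\<And>A B. Q A \<Longrightarrow> Q B \<Longrightarrow> Q (A * B)"
  shows "Q P"
proof (rule frag_induction[of P "{\<mu>. Poly_Mapping.keys \<mu> \<subseteq> V}"])
  show "Poly_Mapping.keys P \<subseteq> {\<mu>. Poly_Mapping.keys \<mu> \<subseteq> V}" using P by auto
  show "Q 0" using diff[OF one one] by simp
  fix \<mu> :: "'v \<Rightarrow>\<^sub>0 nat" assume "\<mu> \<in> {\<mu>. Poly_Mapping.keys \<mu> \<subseteq> V}"
  then have \<mu>: "Poly_Mapping.keys \<mu> \<subseteq> V" by simp
  have pow: "Q (poly_var v ^ n)" if "v \<in> V" for v n
    by (induction n) (auto intro: one mult var that)
  have "Q (\<Prod>v\<in>S. poly_var v ^ Poly_Mapping.lookup \<mu> v)" if "finite S" "S \<subseteq> V" for S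
    using that by (induction S rule: finite_induct) (auto intro: one mult pow)
  from this[OF finite_keys \<mu>] show "Q (frag_of \<mu>)"
    by (simp add: monom_eq_prod_vars)
qed (rule diff)

lemma poly_eval_poly_eval: "poly_eval g (poly_eval f P) = poly_eval (\<lambda>v. poly_eval g (f v)) P"
  by (rule int_poly_induct[of P UNIV]) auto

lemma lookup_of_nat_times:
  "Poly_Mapping.lookup (of_nat n * P) \<mu> = int n * Poly_Mapping.lookup P \<mu>" for P :: "'v int_poly"
  by (induction n) (auto simp: lookup_add algebra_simps)

lemma int_poly_of_nat_cancel:
  fixes P Q :: "'v int_poly"
  assumes "of_nat n * P = of_nat n * Q" "n > 0"
  shows "P = Q"
proof (rule poly_mapping_eqI)
  fix \<mu>
  have "int n * Poly_Mapping.lookup P \<mu> = int n * Poly_Mapping.lookup Q \<mu>"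
    using assms(1) by (metis lookup_of_nat_times)
  then show "Poly_Mapping.lookup P \<mu> = Poly_Mapping.lookup Q \<mu>" using assms(2) by simp
qed


section \<open>Powers and congruences\<close>

lemma dvd_power_diff: "x - y dvd x ^ n - y ^ n" for x y :: "'a::comm_ring_1"
  by (simp add: power_diff_sumr2)

text \<open>In x^p - y^p = (x - y) S the factor S is congruent to p y^(p-1) modulo p, which gains
  one more factor p. This is also why X^p modulo p^(m+1) depends only on X modulo p^m.\<close>

lemma power_p_cong:
  fixes x y :: "'a::comm_ring_1"
  assumes "of_nat p ^ j dvd x - y" "j > 0"
  shows "of_nat p ^ Suc j dvd x ^ p - y ^ p"
proof -
  have p: "of_nat p dvd x - y" using assms by (meson dvd_power dvd_trans)
  have "of_nat p dvd (\<Sum>i<p. y ^ (p - Suc i) * x ^ i)"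
  proof -
    have "of_nat p dvd (\<Sum>i<p. y ^ (p - Suc i) * x ^ i - y ^ (p - 1))"
    proof (rule dvd_sum)
      fix i assume "i \<in> {..<p}"
      then have "y ^ (p - Suc i) * x ^ i - y ^ (p - 1) = y ^ (p - Suc i) * (x ^ i - y ^ i)"
        by (simp add: right_diff_distrib flip: power_add)
      then show "of_nat p dvd y ^ (p - Suc i) * x ^ i - y ^ (p - 1)"
        using dvd_trans[OF p dvd_power_diff] by simp
    qed
    moreover have "(\<Sum>i<p. y ^ (p - Suc i) * x ^ i) =
        (\<Sum>i<p. y ^ (p - Suc i) * x ^ i - y ^ (p - 1)) + of_nat p * y ^ (p - 1)"
      by (simp add: sum_subtractf)
    ultimately show ?thesis by simp
  qed
  with assms(1) have "of_nat p ^ j * of_nat p dvd (x - y) * (\<Sum>i<p. y ^ (p - Suc i) * x ^ i)"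
    by (rule mult_dvd_mono)
  then show ?thesis by (simp add: power_diff_sumr2 mult.commute)
qed

lemma power_p_power_cong:
  fixes x y :: "'a::comm_ring_1"
  assumes "of_nat p dvd x - y"
  shows "of_nat p ^ Suc k dvd x ^ (p ^ k) - y ^ (p ^ k)"
proof (induction k)
  case (Suc k)
  then show ?case using power_p_cong[of p "Suc k"] by (simp add: power_mult mult.commute[of p])
qed (use assms in simp)

lemma prime_dvd_frobenius_add:
  fixes x y :: "'a::comm_ring_1"
  assumes "prime p"
  shows "of_nat p dvd (x + y) ^ p - (x ^ p + y ^ p)"
proof -
  have "{..p} = insert 0 (insert p {0<..<p})" using prime_gt_0_nat[OF assms] by auto
  then have "(x + y) ^ p - (x ^ p + y ^ p) = (\<Sum>i\<in>{0<..<p}. of_nat (p choose i) * x ^ i * y ^ (p - i))"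
    using prime_gt_0_nat[OF assms] by (simp add: binomial_ring)
  moreover have "of_nat p dvd of_nat (p choose i) * x ^ i * y ^ (p - i)" if "i \<in> {0<..<p}" for i
  proof -
    have "p dvd p choose i" using assms that by (intro dvd_choose_prime) auto
    then have "(of_nat p :: 'a) dvd of_nat (p choose i)" by (auto elim!: dvdE)
    then show ?thesis by (simp add: dvd_mult2)
  qed
  then have "of_nat p dvd (\<Sum>i\<in>{0<..<p}. of_nat (p choose i) * x ^ i * y ^ (p - i))"
    by (intro dvd_sum)
  ultimately show ?thesis by simp
qed


section \<open>Ghost components and Witt's theorem\<close>

lemma poly_eval_ghost: "poly_eval f (ghost p s n) = ghost p (\<lambda>i. poly_eval f (s i)) n"
  by (simp add: ghost_def)

lemma ghost_split: "ghost p a n = (\<Sum>i<n. of_nat p ^ i * a i ^ (p ^ (n - i))) + of_nat p ^ n * a n"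
  by (simp add: ghost_def flip: lessThan_Suc_atMost)

lemma ghost_frobenius:
  "ghost p (\<lambda>i. a i ^ p) n = ghost p a (Suc n) - of_nat p ^ Suc n * a (Suc n)"
  by (auto simp: ghost_split[of p a "Suc n"] ghost_def lessThan_Suc_atMost Suc_diff_le
      simp flip: power_mult intro!: sum.cong)

lemma ghost_term_cong:
  fixes x y :: "'a::comm_ring_1"
  assumes "of_nat p dvd x - y" "i \<le> n"
  shows "of_nat p ^ Suc n dvd of_nat p ^ i * x ^ (p ^ (n - i)) - of_nat p ^ i * y ^ (p ^ (n - i))"
proof -
  have "of_nat p ^ i * of_nat p ^ Suc (n - i) dvd of_nat p ^ i * (x ^ (p ^ (n - i)) - y ^ (p ^ (n - i)))"
    by (intro mult_dvd_mono power_p_power_cong assms dvd_refl)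
  moreover have "i + Suc (n - i) = Suc n" using assms(2) by simp
  ultimately show ?thesis
    by (simp only: right_diff_distrib power_add[symmetric])
qed

lemma ghost_cong:
  assumes "\<And>i. i \<le> n \<Longrightarrow> of_nat p dvd a i - b i"
  shows "of_nat p ^ Suc n dvd ghost p a n - ghost p b n"
  unfolding ghost_def sum_subtractf[symmetric]
  by (intro dvd_sum ghost_term_cong assms) auto

text \<open>Once the earlier components agree, p^n a_n = p^n b_n remains, and p^n cancels because
  integer polynomials are torsion free. Over a ring of characteristic p this fails, hence the detour
  through generic vectors for every identity of Witt vectors.\<close>

lemma ghost_inject:
  fixes a b :: "nat \<Rightarrow> 'v int_poly"
  assumes "p > 0" "\<And>n. ghost p a n = ghost p b n"
  shows "a = b"
proof
  fix n show "a n = b n"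
  proof (induction n rule: less_induct)
    case (less n)
    have "of_nat (p ^ n) * a n = of_nat (p ^ n) * b n"
      using assms(2)[of n] less by (simp add: ghost_split)
    from int_poly_of_nat_cancel[OF this] show ?case using assms(1) by simp
  qed
qed

text \<open>The lift of the Frobenius of the polynomial ring modulo p to an endomorphism in
  characteristic zero, as Dwork's criterion requires.\<close>

definition frob :: "nat \<Rightarrow> 'v int_poly \<Rightarrow> 'v int_poly" where
  "frob p = poly_eval (\<lambda>v. poly_var v ^ p)"

lemma frob_cong:
  fixes P :: "'v int_poly"
  assumes p: "prime p"
  shows "of_nat p dvd frob p P - P ^ p"
proof (rule int_poly_induct[of P UNIV])
  fix A B :: "'v int_poly"
  assume A: "of_nat p dvd frob p A - A ^ p" and B: "of_nat p dvd frob p B - B ^ p"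
  have "frob p (A - B) - (A - B) ^ p = (frob p A - A ^ p) - (frob p B - B ^ p)
      + (((A - B) + B) ^ p - ((A - B) ^ p + B ^ p))"
    by (simp add: frob_def)
  then show "of_nat p dvd frob p (A - B) - (A - B) ^ p"
    using A B prime_dvd_frobenius_add[OF p, of "A - B" B] by (metis dvd_add dvd_diff)
  have "frob p (A * B) - (A * B) ^ p = (frob p A - A ^ p) * frob p B + A ^ p * (frob p B - B ^ p)"
    by (simp add: frob_def algebra_simps power_mult_distrib)
  then show "of_nat p dvd frob p (A * B) - (A * B) ^ p"
    using A B by simp
qed (auto simp: frob_def)

text \<open>The recursion can be continued at n iff p^n divides g_n minus the sum of p^i
  s_i^(p^(n-i)) over i < n. That sum is the ghost component n - 1 of the vector (s_i^p), which
  modulo p^n agrees with that of (frob s_i), that is with frob g_(n-1), and so with g_n by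
  hypothesis.\<close>

lemma dwork_criterion:
  fixes g :: "nat \<Rightarrow> 'v int_poly"
  assumes p: "prime p"
    and g: "\<And>n. of_nat p ^ Suc n dvd g (Suc n) - frob p (g n)"
  shows "\<exists>s. \<forall>n. ghost p s n = g n"
proof -
  define Q where "Q = (\<lambda>s n r. of_nat p ^ n * r = g n - (\<Sum>i<n. of_nat p ^ i * s i ^ (p ^ (n - i))))"
  have "\<exists>s. \<forall>n. Q s n (s n)"
  proof (rule dependent_wellorder_choice)
    fix r and s t :: "nat \<Rightarrow> 'v int_poly" and n
    assume "\<And>m. m < n \<Longrightarrow> s m = t m"
    then show "Q s n r = Q t n r" by (simp add: Q_def)
  next
    fix n and s :: "nat \<Rightarrow> 'v int_poly"
    assume s: "\<And>m. m < n \<Longrightarrow> Q s m (s m)"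
    show "\<exists>r. Q s n r"
    proof (cases n)
      case (Suc k)
      have "ghost p s k = g k"
        using s[of k] Suc by (simp add: Q_def ghost_split)
      then have "frob p (g k) = ghost p (\<lambda>i. frob p (s i)) k"
        by (metis frob_def poly_eval_ghost)
      moreover have "of_nat p ^ Suc k dvd ghost p (\<lambda>i. frob p (s i)) k - ghost p (\<lambda>i. s i ^ p) k"
        by (intro ghost_cong frob_cong p)
      moreover have "ghost p (\<lambda>i. s i ^ p) k = (\<Sum>i<n. of_nat p ^ i * s i ^ (p ^ (n - i)))"
        by (simp add: ghost_frobenius ghost_split[of p s "Suc k"] Suc)
      ultimately have "of_nat p ^ n dvd (g n - frob p (g k)) +
          (frob p (g k) - (\<Sum>i<n. of_nat p ^ i * s i ^ (p ^ (n - i))))"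
        using g[of k] Suc by (intro dvd_add) auto
      then show ?thesis by (auto simp: Q_def elim!: dvdE)
    qed (simp add: Q_def)
  qed
  then obtain s where "\<And>n. Q s n (s n)" by blast
  then have "ghost p s n = g n" for n by (simp add: Q_def ghost_split)
  then show ?thesis by blast
qed

text \<open>What carries the hypothesis of Dwork's criterion from two ghost sequences to their
  combination under f. Negation is treated as an operation that ignores its second argument, so that
  additive inverses come from the same construction.\<close>

definition frob_compat :: "nat \<Rightarrow> ('v int_poly \<Rightarrow> 'v int_poly \<Rightarrow> 'v int_poly) \<Rightarrow> bool" where
  "frob_compat p f \<longleftrightarrow> (\<forall>P Q. frob p (f P Q) = f (frob p P) (frob p Q)) \<and>
     (\<forall>d P Q P' Q'. d dvd P - P' \<longrightarrow> d dvd Q - Q' \<longrightarrow> d dvd f P Q - f P' Q')"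

lemma frob_compat_ops:
  "frob_compat p (\<lambda>P Q. P + Q)" "frob_compat p (\<lambda>P Q. P * Q)" "frob_compat p (\<lambda>P Q. - P)"
proof -
  have "d dvd (P + Q) - (P' + Q')" if "d dvd P - P'" "d dvd Q - Q'" for d P Q P' Q' :: "'v int_poly"
    using dvd_add[OF that] by (simp add: algebra_simps)
  moreover have "d dvd P * Q - P' * Q'" if "d dvd P - P'" "d dvd Q - Q'" for d P Q P' Q' :: "'v int_poly"
  proof -
    have "d dvd (P - P') * Q + P' * (Q - Q')" using that by simp
    then show ?thesis by (simp add: algebra_simps)
  qed
  moreover have "d dvd - P - (- P')" if "d dvd P - P'" for d P P' :: "'v int_poly"
    using that by (metis dvd_minus_iff minus_diff_minus)
  ultimately show "frob_compat p (\<lambda>P Q. P + Q :: 'v int_poly)" "frob_compat p (\<lambda>P Q. P * Q :: 'v int_poly)"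
    "frob_compat p (\<lambda>P Q. - P :: 'v int_poly)"
    by (auto simp: frob_compat_def frob_def)
qed

text \<open>Dwork's criterion gives existence and \<open>ghost_inject\<close> uniqueness, so the
  description in \<open>witt_polys\<close> denotes. For a vector of variables, ghost component n + 1
  minus \<open>frob\<close> of component n is exactly p^(n+1) times the last variable.\<close>

theorem ghost_witt_polys:
  assumes p: "prime p" and f: "frob_compat p f"
  shows "ghost p (witt_polys p f) n =
     f (ghost p (\<lambda>i. poly_var (Inl i)) n) (ghost p (\<lambda>i. poly_var (Inr i)) n)"
proof -
  let ?G = "\<lambda>n. f (ghost p (\<lambda>i. poly_var (Inl i)) n) (ghost p (\<lambda>i. poly_var (Inr i)) n)"
  have frob_ghost: "of_nat p ^ Suc n dvd ghost p (\<lambda>i. poly_var (h i)) (Suc n) - frob p (ghost p (\<lambda>i. poly_var (h i)) n)"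
    for h :: "nat \<Rightarrow> nat + nat" and n
    by (simp only: frob_def poly_eval_ghost poly_eval_var ghost_frobenius) simp
  have "\<exists>s. \<forall>n. ghost p s n = ?G n"
    using f frob_ghost unfolding frob_compat_def by (intro dwork_criterion p) metis
  then have "\<exists>!s. \<forall>n. ghost p s n = ?G n"
    using ghost_inject[of p] prime_gt_0_nat[OF p] by metis
  from theI'[OF this] show ?thesis unfolding witt_polys_def by blast
qed


section \<open>The ring of Witt vectors\<close>

definition witt_op :: "nat \<Rightarrow> ((nat + nat) int_poly \<Rightarrow> (nat + nat) int_poly \<Rightarrow> (nat + nat) int_poly)
    \<Rightarrow> (nat \<Rightarrow> 'a) \<Rightarrow> (nat \<Rightarrow> 'a) \<Rightarrow> nat \<Rightarrow> 'a::comm_ring_1" where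
  "witt_op p f a b n = poly_eval (case_sum a b) (witt_polys p f n)"

abbreviation "witt_add p \<equiv> witt_op p (\<lambda>P Q. P + Q)"
abbreviation "witt_mul p \<equiv> witt_op p (\<lambda>P Q. P * Q)"
abbreviation "witt_neg p a \<equiv> witt_op p (\<lambda>P Q. - P) a a"
abbreviation witt_one :: "nat \<Rightarrow> 'a::comm_ring_1" where "witt_one \<equiv> \<lambda>n. if n = 0 then 1 else 0"

lemma ghost_witt_op:
  assumes "prime p"
  shows "ghost p (witt_add p a b) n = ghost p a n + ghost p b n"
    "ghost p (witt_mul p a b) n = ghost p a n * ghost p b n"
    "ghost p (witt_neg p a) n = - ghost p a n"
proof -
  have *: "ghost p (witt_op p f a b) n = poly_eval (case_sum a b) (ghost p (witt_polys p f) n)" for f b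
    by (simp add: poly_eval_ghost witt_op_def[abs_def])
  show "ghost p (witt_add p a b) n = ghost p a n + ghost p b n"
    "ghost p (witt_mul p a b) n = ghost p a n * ghost p b n"
    "ghost p (witt_neg p a) n = - ghost p a n"
    by (simp_all add: * ghost_witt_polys[OF assms] frob_compat_ops poly_eval_ghost)
qed

lemma ghost_zero: "p > 0 \<Longrightarrow> ghost p (\<lambda>n. 0) n = 0"
  by (simp add: ghost_def power_0_left)

lemma ghost_one: "p > 0 \<Longrightarrow> ghost p witt_one n = 1"
  by (simp add: ghost_def sum.atMost_shift power_0_left)

lemma poly_eval_witt_op:
  "(\<lambda>n. poly_eval e (witt_op p f a b n)) = witt_op p f (\<lambda>n. poly_eval e (a n)) (\<lambda>n. poly_eval e (b n))"
proof
  fix n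
  have "(\<lambda>v. poly_eval e (case_sum a b v)) = case_sum (\<lambda>n. poly_eval e (a n)) (\<lambda>n. poly_eval e (b n))"
    by (auto split: sum.splits)
  then show "poly_eval e (witt_op p f a b n) = witt_op p f (\<lambda>n. poly_eval e (a n)) (\<lambda>n. poly_eval e (b n)) n"
    by (simp add: witt_op_def poly_eval_poly_eval)
qed

text \<open>Identities between Witt vectors are checked on the ghost components of generic vectors.\<close>

lemma generic_vectors:
  fixes a b c :: "nat \<Rightarrow> 'a::comm_ring_1"
  obtains A B C :: "nat \<Rightarrow> (nat \<times> nat) int_poly" and e where
    "a = (\<lambda>n. poly_eval e (A n))" "b = (\<lambda>n. poly_eval e (B n))" "c = (\<lambda>n. poly_eval e (C n))"
proof
  let ?e = "\<lambda>(j::nat, n). if j = 0 then a n else if j = 1 then b n else c n"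
  show "a = (\<lambda>n. poly_eval ?e (poly_var (0, n)))" "b = (\<lambda>n. poly_eval ?e (poly_var (1, n)))"
    "c = (\<lambda>n. poly_eval ?e (poly_var (2, n)))"
    by simp_all
qed

lemma witt_ring_axioms:
  fixes a b c :: "nat \<Rightarrow> 'a::comm_ring_1"
  assumes p: "prime p"
  shows "witt_add p (witt_add p a b) c = witt_add p a (witt_add p b c)" (is ?t1)
    "witt_add p a b = witt_add p b a" (is ?t2)
    "witt_add p (\<lambda>n. 0) a = a" (is ?t3)
    "witt_add p (witt_neg p a) a = (\<lambda>n. 0)" (is ?t4)
    "witt_mul p (witt_mul p a b) c = witt_mul p a (witt_mul p b c)" (is ?t5)
    "witt_mul p a b = witt_mul p b a" (is ?t6)
    "witt_mul p witt_one a = a" (is ?t7)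
    "witt_mul p (witt_add p a b) c = witt_add p (witt_mul p a c) (witt_mul p b c)" (is ?t8)
proof -
  obtain A B C :: "nat \<Rightarrow> (nat \<times> nat) int_poly" and e where
    abc: "a = (\<lambda>n. poly_eval e (A n))" "b = (\<lambda>n. poly_eval e (B n))" "c = (\<lambda>n. poly_eval e (C n))"
    using generic_vectors[of a b c] .
  have zero: "(\<lambda>n. 0) = (\<lambda>n. poly_eval e 0)" and one: "witt_one = (\<lambda>n. poly_eval e (witt_one n))"
    by auto
  note gh = ghost_witt_op[OF p] ghost_zero ghost_one prime_gt_0_nat[OF p]
  note inj = ghost_inject[OF prime_gt_0_nat[OF p]]
  note ev = abc poly_eval_witt_op[symmetric]
  have "witt_add p (witt_add p A B) C = witt_add p A (witt_add p B C)"
    by (rule inj) (simp add: gh)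
  then show ?t1 unfolding ev by simp
  have "witt_add p A B = witt_add p B A"
    by (rule inj) (simp add: gh)
  then show ?t2 unfolding ev by simp
  have "witt_add p (\<lambda>n. 0) A = A"
    by (rule inj) (simp add: gh)
  then show ?t3 unfolding zero ev by simp
  have "witt_add p (witt_neg p A) A = (\<lambda>n. 0)"
    by (rule inj) (simp add: gh)
  then show ?t4 unfolding ev by simp
  have "witt_mul p (witt_mul p A B) C = witt_mul p A (witt_mul p B C)"
    by (rule inj) (simp add: gh)
  then show ?t5 unfolding ev by simp
  have "witt_mul p A B = witt_mul p B A"
    by (rule inj) (simp add: gh)
  then show ?t6 unfolding ev by simp
  have "witt_mul p witt_one A = A"
    by (rule inj) (simp add: gh)
  then show ?t7 by (subst one) (simp only: ev)
  have "witt_mul p (witt_add p A B) C = witt_add p (witt_mul p A C) (witt_mul p B C)"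
    by (rule inj) (simp add: gh algebra_simps)
  then show ?t8 unfolding ev by simp
qed

lemma witt_op_coord_0:
  assumes "prime p"
  shows "witt_add p a b 0 = a 0 + b 0" "witt_mul p a b 0 = a 0 * b 0" "witt_neg p a 0 = - a 0"
  using ghost_witt_op(1,2)[OF assms, of a b 0] ghost_witt_op(3)[OF assms, of a 0] by (simp_all add: ghost_def)

text \<open>This is p = V F in characteristic p. For generic A the ghost components of p A and V F A
  differ by p^(n+1) A_n; inductively the components themselves agree modulo p, and evaluation in
  characteristic p removes the difference. The multiple is an iterated sum because Witt vectors are
  not yet a ring type here.\<close>

lemma witt_times_p:
  fixes a :: "nat \<Rightarrow> 'a::comm_ring_1"
  assumes p: "prime p" and char: "CHAR('a) = p"
  shows "(witt_add p a ^^ p) (\<lambda>n. 0) = (\<lambda>n. case n of 0 \<Rightarrow> 0 | Suc n \<Rightarrow> a n ^ p)"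
proof -
  obtain A B C :: "nat \<Rightarrow> (nat \<times> nat) int_poly" and e where
    a: "a = (\<lambda>n. poly_eval e (A n))"
    using generic_vectors[of a a a] .
  define V where "V = (\<lambda>n. case n of 0 \<Rightarrow> 0 | Suc n \<Rightarrow> A n ^ p)"
  define M where "M = (witt_add p A ^^ p) (\<lambda>n. 0)"
  have p0: "p > 0" using p by (rule prime_gt_0_nat)
  have "ghost p ((witt_add p A ^^ j) (\<lambda>n. 0)) n = of_nat j * ghost p A n" for j n
    by (induction j) (simp_all add: ghost_zero p0 ghost_witt_op[OF p] algebra_simps)
  then have M: "ghost p M n = of_nat p * ghost p A n" for n by (simp add: M_def)
  have V: "ghost p V n = of_nat p * ghost p A n - of_nat p ^ Suc n * A n" for n
  proof (cases n)
    case (Suc k)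
    have "ghost p V n = of_nat p * ghost p (\<lambda>i. A i ^ p) k"
      using p0 by (simp add: ghost_def V_def Suc sum.atMost_Suc_shift sum_distrib_left power_0_left mult_ac del: sum.atMost_Suc)
    then show ?thesis by (simp add: ghost_frobenius Suc algebra_simps)
  qed (simp add: V_def ghost_def)
  have cong: "of_nat p dvd M n - V n" for n
  proof (induction n rule: less_induct)
    case (less n)
    have "of_nat p ^ Suc n dvd (\<Sum>i<n. of_nat p ^ i * M i ^ (p ^ (n - i)) - of_nat p ^ i * V i ^ (p ^ (n - i)))"
      using less by (intro dvd_sum ghost_term_cong) auto
    moreover have "of_nat p ^ Suc n dvd ghost p M n - ghost p V n"
      by (simp add: M V)
    ultimately have "of_nat p ^ Suc n dvd (ghost p M n - ghost p V n) -
        (\<Sum>i<n. of_nat p ^ i * M i ^ (p ^ (n - i)) - of_nat p ^ i * V i ^ (p ^ (n - i)))"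
      by (rule dvd_diff[rotated])
    also have "\<dots> = of_nat p ^ n * (M n - V n)"
      by (simp add: ghost_split sum_subtractf algebra_simps)
    finally obtain Z where "of_nat p ^ n * (M n - V n) = of_nat p ^ Suc n * Z" by (elim dvdE)
    then have "of_nat (p ^ n) * (M n - V n) = of_nat (p ^ n) * (of_nat p * Z)"
      by (simp add: mult_ac)
    from int_poly_of_nat_cancel[OF this] p0 show ?case by simp
  qed
  have "poly_eval e (M n) = poly_eval e (V n)" for n
  proof -
    obtain Z where "M n - V n = of_nat p * Z" using cong[of n] by (elim dvdE)
    then have "poly_eval e (M n) - poly_eval e (V n) = of_nat p * poly_eval e Z"
      by (metis poly_eval_diff poly_eval_mult poly_eval_of_nat)
    then show ?thesis by (simp add: of_nat_CHAR flip: char)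
  qed
  moreover have "(witt_add p a ^^ j) (\<lambda>n. 0) = (\<lambda>n. poly_eval e ((witt_add p A ^^ j) (\<lambda>n. 0) n))" for j
    by (induction j) (simp_all add: poly_eval_witt_op a)
  ultimately show ?thesis
    by (auto simp: M_def V_def a split: nat.splits)
qed


text \<open>
  The Witt vectors over \<open>'a\<close> are made a commutative ring type in order to compute in them by
  type class reasoning. Their prime is the characteristic of \<open>'a\<close> if that is prime; the value
  \<open>2\<close> otherwise only serves to have an instance for every commutative ring.
\<close>

datatype 'a witt = Witt (coords: "nat \<Rightarrow> 'a")

definition witt_prime :: "'a::comm_ring_1 itself \<Rightarrow> nat" where
  "witt_prime _ = (if prime CHAR('a) then CHAR('a) else 2)"

lemma prime_witt_prime: "prime (witt_prime T)"
  by (simp add: witt_prime_def)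

instantiation witt :: (comm_ring_1) comm_ring_1
begin

definition "0 = Witt (\<lambda>n. 0)"
definition "1 = Witt witt_one"
definition "a + b = Witt (witt_add (witt_prime TYPE('a)) (coords a) (coords b))"
definition "a * b = Witt (witt_mul (witt_prime TYPE('a)) (coords a) (coords b))"
definition "- a = Witt (witt_neg (witt_prime TYPE('a)) (coords a))"
definition minus_witt :: "'a witt \<Rightarrow> 'a witt \<Rightarrow> 'a witt" where "minus_witt a b = a + - b"

instance
proof
  note defs = zero_witt_def one_witt_def plus_witt_def times_witt_def uminus_witt_def minus_witt_def
  note ax = witt_ring_axioms[OF prime_witt_prime]
  fix a b c :: "'a witt"
  show "a + b + c = a + (b + c)" by (simp add: defs ax(1))
  show "a + b = b + a" by (simp add: defs ax(2))
  show "0 + a = a" by (simp add: defs ax(3))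
  show "- a + a = 0" by (simp add: defs ax(4))
  show "a - b = a + - b" by (simp add: minus_witt_def)
  show "a * b * c = a * (b * c)" by (simp add: defs ax(5))
  show "a * b = b * a" by (simp add: defs ax(6))
  show "1 * a = a" by (simp add: defs ax(7))
  show "(a + b) * c = a * c + b * c" by (simp add: defs ax(8))
  show "(0::'a witt) \<noteq> 1" by (auto simp: defs fun_eq_iff intro!: exI[of _ 0])
qed

end

lemma coords_ops:
  fixes a b :: "'a::comm_ring_1 witt"
  assumes "prime p" "CHAR('a) = p"
  shows "coords (a + b) = witt_add p (coords a) (coords b)"
    "coords (a * b) = witt_mul p (coords a) (coords b)"
    "coords (0::'a witt) = (\<lambda>n. 0)" "coords (1::'a witt) = witt_one"
  using assms by (auto simp: plus_witt_def times_witt_def zero_witt_def one_witt_def witt_prime_def)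

lemma coords_inject: "coords a = coords b \<longleftrightarrow> a = b"
  by (metis witt.collapse)

lemma coords_0_hom:
  fixes a b :: "'a::comm_ring_1 witt"
  shows "coords (a + b) 0 = coords a 0 + coords b 0" "coords (a - b) 0 = coords a 0 - coords b 0"
    "coords (a ^ n) 0 = coords a 0 ^ n"
proof -
  show "coords (a + b) 0 = coords a 0 + coords b 0" "coords (a - b) 0 = coords a 0 - coords b 0"
    unfolding minus_witt_def
    by (simp_all add: plus_witt_def uminus_witt_def witt_op_coord_0 prime_witt_prime del: add_uminus_conv_diff)
  show "coords (a ^ n) 0 = coords a 0 ^ n"
    by (induction n) (simp_all add: one_witt_def times_witt_def witt_op_coord_0 prime_witt_prime)
qed

section \<open>Multiplication by p and the Frobenius of W/p\<close>

lemma coords_p_times: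
  fixes a :: "'a::comm_ring_1 witt"
  assumes p: "prime p" "CHAR('a) = p"
  shows "coords (of_nat p * a) = (\<lambda>n. case n of 0 \<Rightarrow> 0 | Suc n \<Rightarrow> coords a n ^ p)"
proof -
  have "coords (of_nat j * a) = (witt_add p (coords a) ^^ j) (\<lambda>n. 0)" for j
    by (induction j) (simp_all add: coords_ops(1,3)[OF p] distrib_right)
  then show ?thesis using witt_times_p[OF p] by metis
qed

lemma coords_p_times_nth:
  fixes a :: "'a::comm_ring_1 witt"
  assumes p: "prime p" "CHAR('a) = p"
  shows "coords (of_nat p * a) 0 = 0" "coords (of_nat p * a) (Suc n) = coords a n ^ p"
  unfolding coords_p_times[OF p] by simp_all

lemma witt_p_torsion_free:
  fixes a :: "'k::field witt"
  assumes p: "prime p" "CHAR('k) = p" and "of_nat p * a = 0"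
  shows "a = 0"
proof -
  have "coords a n ^ p = 0" for n
    using coords_p_times_nth(2)[OF p, of a n] unfolding assms(3) coords_ops(3)[OF p] by simp
  then have "coords a = coords 0" unfolding coords_ops(3)[OF p] by auto
  then show ?thesis by (simp only: coords_inject)
qed

text \<open>Multiplication by p raises coordinates to the p-th power and shifts them. A vector with
  vanishing coordinate 0 is therefore divided by p by shifting back and extracting p-th roots. Thus
  W/p is k via coordinate 0.\<close>

lemma witt_p_dvd_iff:
  fixes a :: "'k::field witt"
  assumes p: "prime p" "CHAR('k) = p" and surj: "surj (\<lambda>x::'k. x ^ p)"
  shows "of_nat p dvd a \<longleftrightarrow> coords a 0 = 0"
proof
  assume "coords a 0 = 0"
  obtain r where r: "\<And>x::'k. r x ^ p = x"
    using surj_f_inv_f[OF surj] by blast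
  let ?b = "Witt (\<lambda>n. r (coords a (Suc n)))"
  have "coords (of_nat p * ?b) n = coords a n" for n
    using \<open>coords a 0 = 0\<close> by (cases n) (simp_all add: coords_p_times_nth[OF p] r)
  then have "coords (of_nat p * ?b) = coords a" by (rule ext)
  then show "of_nat p dvd a" by (metis coords_inject dvdI)
next
  assume "of_nat p dvd a"
  then obtain b where "a = of_nat p * b" by (elim dvdE)
  then show "coords a 0 = 0" by (simp only: coords_p_times_nth[OF p])
qed

lemma witt_p_dvd_power:
  fixes a :: "'k::field witt"
  assumes p: "prime p" "CHAR('k) = p" and surj: "surj (\<lambda>x::'k. x ^ p)" and "of_nat p dvd a ^ p"
  shows "of_nat p dvd a"
  using assms(4) unfolding witt_p_dvd_iff[OF p surj] coords_0_hom by simp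

lemma witt_p_root:
  fixes a :: "'k::field witt"
  assumes p: "prime p" "CHAR('k) = p" and surj: "surj (\<lambda>x::'k. x ^ p)"
  shows "\<exists>b c. a = b ^ p + of_nat p * c"
proof -
  obtain x where x: "coords a 0 = x ^ p" using surjD[OF surj] by blast
  \<comment> \<open>Only coordinate 0 of the vector counts modulo p; the constant vector is one of
    many choices.\<close>
  have "of_nat p dvd a - Witt (\<lambda>n. x) ^ p"
    by (simp add: witt_p_dvd_iff[OF p surj] coords_0_hom x)
  then obtain c where "a - Witt (\<lambda>n. x) ^ p = of_nat p * c" by (elim dvdE)
  then have "a = Witt (\<lambda>n. x) ^ p + of_nat p * c" by (simp add: algebra_simps)
  then show ?thesis by blast
qed


section \<open>Quotients of a ring type as ring structures\<close>

text \<open>Presents a structure with carrier as the quotient of a ring type by the principal ideal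
  of q, with class map \<open>cls\<close>, so that its arithmetic becomes congruences in the type.
  With q = 0 it is an isomorphic copy of the type, which serves for
  \<open>witt_ring\<close>.\<close>

locale ring_modulo =
  fixes q :: "'a::comm_ring_1" and M :: "('b, 'c) ring_scheme" (structure) and cls :: "'a \<Rightarrow> 'b"
  assumes carrier_eq: "carrier M = range cls"
    and cls_eq_iff: "cls a = cls b \<longleftrightarrow> q dvd a - b"
    and cls_mult: "cls a \<otimes> cls b = cls (a * b)"
    and cls_add: "cls a \<oplus> cls b = cls (a + b)"
    and one_eq: "\<one> = cls 1"
    and zero_eq: "\<zero> = cls 0"
begin

lemma cls_closed [simp]: "cls a \<in> carrier M"
  by (simp add: carrier_eq)

lemma carrierE: assumes "x \<in> carrier M" obtains a where "x = cls a"
  using assms by (auto simp: carrier_eq)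

lemma abelian_group: "abelian_group M"
proof (rule abelian_groupI)
  fix x assume "x \<in> carrier M"
  then obtain a where "x = cls a" by (rule carrierE)
  then have "cls (- a) \<oplus> x = \<zero>" by (simp add: cls_add zero_eq)
  then show "\<exists>y\<in>carrier M. y \<oplus> x = \<zero>" by (rule bexI) simp
qed (auto simp: carrier_eq cls_add zero_eq algebra_simps)

lemma cring: "cring M"
  by (rule cringI[OF abelian_group])
    (auto simp: carrier_eq cls_mult cls_add one_eq algebra_simps intro!: comm_monoidI)

sublocale cring M by (rule cring)

lemma cls_minus: "\<ominus> cls a = cls (- a)"
  by (rule minus_equality) (simp_all add: cls_add zero_eq)

lemma cls_pow: "cls a [^] n = cls (a ^ n)" for n :: nat
  by (induction n) (simp_all add: one_eq cls_mult mult.commute)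

lemma cls_nat_mult: "[n] \<cdot> cls a = cls (of_nat n * a)" for n :: nat
  by (induction n) (simp_all add: zero_eq cls_add algebra_simps)

lemma cls_int_mult: "[l] \<cdot> cls a = cls (of_int l * a)" for l :: int
proof (cases l)
  case (nonneg n)
  then show ?thesis by (simp add: cls_nat_mult add_pow_int_ge)
next
  case (neg n)
  then show ?thesis by (simp add: cls_nat_mult cls_minus add_pow_int_lt del: of_nat_Suc)
qed

end

lemma witt_ring_simps:
  "carrier (witt_ring p) = UNIV"
  "mult (witt_ring p) = witt_mul p" "add (witt_ring p) = witt_add p"
  "\<one>\<^bsub>witt_ring p\<^esub> = witt_one" "\<zero>\<^bsub>witt_ring p\<^esub> = (\<lambda>n. 0)"
  by (auto simp: witt_ring_def witt_op_def fun_eq_iff)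

lemma ring_modulo_witt_ring:
  assumes "prime p" "CHAR('a::comm_ring_1) = p"
  shows "ring_modulo 0 (witt_ring p) (coords :: 'a witt \<Rightarrow> _)"
proof
  show "carrier (witt_ring p) = range (coords :: 'a witt \<Rightarrow> _)"
    by (auto simp: witt_ring_simps) (metis rangeI witt.sel)
qed (simp_all add: witt_ring_simps coords_ops[OF assms] coords_inject)

definition witt_cls :: "nat \<Rightarrow> nat \<Rightarrow> 'a::comm_ring_1 witt \<Rightarrow> (nat \<Rightarrow> 'a) set" where
  "witt_cls p j a = witt_ideal p j +>\<^bsub>witt_ring p\<^esub> coords a"

lemma ring_modulo_witt_quot:
  assumes p: "prime p" "CHAR('a::comm_ring_1) = p"
  shows "ring_modulo (of_nat p ^ j) (witt_quot p j) (witt_cls p j :: 'a witt \<Rightarrow> _)"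
proof -
  interpret R: ring_modulo 0 "witt_ring p" "coords :: 'a witt \<Rightarrow> _"
    by (rule ring_modulo_witt_ring[OF p])
  let ?I = "witt_ideal p j :: (nat \<Rightarrow> 'a) set"
  have gen: "[(p ^ j)] \<cdot>\<^bsub>witt_ring p\<^esub> \<one>\<^bsub>witt_ring p\<^esub> = coords (of_nat p ^ j :: 'a witt)"
    by (simp add: R.one_eq R.cls_nat_mult)
  have "{x \<otimes>\<^bsub>witt_ring p\<^esub> coords q | x. x \<in> carrier (witt_ring p)} = coords ` range (\<lambda>b. b * q)"
    for q :: "'a witt"
    by (auto simp: R.carrier_eq R.cls_mult) (metis R.cls_mult rangeI)
  moreover have "range (\<lambda>b. b * q) = {a. q dvd a}" for q :: "'a witt"
    by (auto simp: dvd_def mult.commute)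
  ultimately have I: "?I = coords ` {a. of_nat p ^ j dvd a}"
    unfolding witt_ideal_def gen cgenideal_def by simp
  interpret I: ideal ?I "witt_ring p"
    unfolding witt_ideal_def gen by (rule R.cgenideal_ideal) simp
  have cls: "witt_cls p j a = {coords b | b. of_nat p ^ j dvd b - a}" for a :: "'a witt"
  proof -
    have "witt_cls p j a = coords ` (\<lambda>b. b + a) ` {b. of_nat p ^ j dvd b}"
      by (simp add: witt_cls_def a_r_coset_def' I R.cls_add image_image UNION_singleton_eq_range)
    also have "(\<lambda>b. b + a) ` {b. of_nat p ^ j dvd b} = {b. of_nat p ^ j dvd b - a}"
    proof (intro equalityI subsetI)
      fix b assume "b \<in> {b. of_nat p ^ j dvd b - a}"
      then have "b - a \<in> {b. of_nat p ^ j dvd b}" "b = (b - a) + a" by simp_all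
      then show "b \<in> (\<lambda>b. b + a) ` {b. of_nat p ^ j dvd b}" by (rule rev_image_eqI)
    qed auto
    finally show ?thesis by (simp only: image_Collect)
  qed
  show ?thesis
  proof
    show "carrier (witt_quot p j) = range (witt_cls p j :: 'a witt \<Rightarrow> _)"
      by (auto simp: witt_quot_def FactRing_def A_RCOSETS_def' R.carrier_eq witt_cls_def)
    fix a b :: "'a witt"
    show "witt_cls p j a = witt_cls p j b \<longleftrightarrow> of_nat p ^ j dvd a - b"
    proof
      assume "witt_cls p j a = witt_cls p j b"
      moreover have "coords a \<in> witt_cls p j a" by (auto simp: cls)
      ultimately show "of_nat p ^ j dvd a - b" by (auto simp: cls coords_inject)
    next
      assume *: "of_nat p ^ j dvd a - b"
      have "of_nat p ^ j dvd c - a \<longleftrightarrow> of_nat p ^ j dvd c - b" for c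
        using dvd_add_left_iff[OF *, of "c - a"] by simp
      then show "witt_cls p j a = witt_cls p j b" by (auto simp: cls)
    qed
    show "witt_cls p j a \<otimes>\<^bsub>witt_quot p j\<^esub> witt_cls p j b = witt_cls p j (a * b)"
      by (simp add: witt_quot_def FactRing_def witt_cls_def I.rcoset_mult_add R.cls_mult)
    show "witt_cls p j a \<oplus>\<^bsub>witt_quot p j\<^esub> witt_cls p j b = witt_cls p j (a + b)"
      by (simp add: witt_quot_def FactRing_def witt_cls_def I.a_rcos_sum R.cls_add)
    show "\<one>\<^bsub>witt_quot p j\<^esub> = witt_cls p j (1 :: 'a witt)"
      by (simp add: witt_quot_def FactRing_def witt_cls_def R.one_eq)
    have "\<zero>\<^bsub>witt_quot p j\<^esub> = ?I" by (simp add: witt_quot_def FactRing_def)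
    then show "\<zero>\<^bsub>witt_quot p j\<^esub> = witt_cls p j (0 :: 'a witt)" by (auto simp: cls I)
  qed
qed

lemma witt_lifts_iff:
  "witt_lifts p i j X x \<longleftrightarrow> (\<exists>a. X = witt_cls p i a \<and> x = witt_cls p j a)"
  by (auto simp: witt_lifts_def witt_cls_def witt_ring_simps) (metis witt.sel)


section \<open>The ring of divided power sequences\<close>

text \<open>
  A sequence \<open>(a\<^sub>n)\<close> stands for \<open>\<Sum>\<^sub>n a\<^sub>n t\<^sup>[\<^sup>n\<^sup>]\<close> with divided powers
  \<open>t\<^sup>[\<^sup>n\<^sup>]\<close> of a variable \<open>t\<close>.
\<close>

datatype 'a hurwitz = Hurwitz (hcoeff: "nat \<Rightarrow> 'a")

lemma hurwitz_eqI: "(\<And>n. hcoeff a n = hcoeff b n) \<Longrightarrow> a = b"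
  by (cases a; cases b) auto

instantiation hurwitz :: (comm_ring_1) comm_ring_1
begin

definition "0 = Hurwitz (\<lambda>n. 0)"
definition "1 = Hurwitz (\<lambda>n. if n = 0 then 1 else 0)"
definition "a + b = Hurwitz (\<lambda>n. hcoeff a n + hcoeff b n)"
definition "a - b = Hurwitz (\<lambda>n. hcoeff a n - hcoeff b n)"
definition "- a = Hurwitz (\<lambda>n. - hcoeff a n)"
definition "a * b = Hurwitz (\<lambda>n. \<Sum>i=0..n. of_nat (n choose i) * (hcoeff a i * hcoeff b (n - i)))"

instance
proof
  note defs = zero_hurwitz_def one_hurwitz_def plus_hurwitz_def times_hurwitz_def uminus_hurwitz_def
    minus_hurwitz_def
  fix a b c :: "'a hurwitz"
  show "a * b * c = a * (b * c)"
  proof (rule hurwitz_eqI)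
    fix n
    \<comment> \<open>The coefficient is the trinomial n! / (j! i! l!) when j + i + l = n. Both
      bracketings sum these terms, and only the order of summation differs, exactly as for power
      series.\<close>
    define f where "f = (\<lambda>j i l. of_nat ((n choose j) * ((n - j) choose i)) * (hcoeff a j * hcoeff b i * hcoeff c l))"
    have "hcoeff (a * b * c) n = (\<Sum>j=0..n. \<Sum>i=0..j. f i (j - i) (n - j))"
      unfolding times_hurwitz_def f_def
    proof (simp add: sum_distrib_left sum_distrib_right, intro sum.cong refl)
      fix j i assume "j \<in> {0..n}" "i \<in> {0..j}"
      then have "(n choose j) * (j choose i) = (n choose i) * ((n - i) choose (j - i))"
        by (intro choose_mult) auto
      then have "(of_nat (n choose j) * of_nat (j choose i) :: 'a)
          = of_nat (n choose i) * of_nat ((n - i) choose (j - i))"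
        by (metis of_nat_mult)
      then show "of_nat (n choose j) * (of_nat (j choose i) * (hcoeff a i * hcoeff b (j - i)) * hcoeff c (n - j))
          = of_nat (n choose i) * of_nat ((n - i) choose (j - i)) * (hcoeff a i * hcoeff b (j - i) * hcoeff c (n - j))"
        by (simp flip: mult.assoc)
    qed
    also have "\<dots> = (\<Sum>j=0..n. \<Sum>i=0..n - j. f j i (n - j - i))"
      by (rule fps_mult_assoc_lemma)
    also have "\<dots> = hcoeff (a * (b * c)) n"
      by (simp add: times_hurwitz_def f_def sum_distrib_left mult_ac)
    finally show "hcoeff (a * b * c) n = hcoeff (a * (b * c)) n" .
  qed
  show "a * b = b * a"
  proof (rule hurwitz_eqI)
    fix n
    show "hcoeff (a * b) n = hcoeff (b * a) n"
      unfolding times_hurwitz_def hurwitz.sel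
      by (subst sum.atLeastAtMost_rev, rule sum.cong) (auto simp: binomial_symmetric[symmetric] mult.commute)
  qed
  show "1 * a = a"
    by (rule hurwitz_eqI) (simp add: defs sum.atLeast_Suc_atMost)
  show "(a + b) * c = a * c + b * c"
    by (rule hurwitz_eqI) (simp add: defs algebra_simps sum.distrib)
  show "(0::'a hurwitz) \<noteq> 1" by (auto simp: defs fun_eq_iff intro!: exI[of _ 0])
qed (rule hurwitz_eqI, simp add: plus_hurwitz_def zero_hurwitz_def minus_hurwitz_def uminus_hurwitz_def)+

end

lemma hcoeff_simps [simp]:
  fixes a b :: "'a::comm_ring_1 hurwitz"
  shows "hcoeff (0 :: 'a hurwitz) n = 0" "hcoeff (a + b) n = hcoeff a n + hcoeff b n"
    "hcoeff (a - b) n = hcoeff a n - hcoeff b n"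
  by (simp_all add: zero_hurwitz_def plus_hurwitz_def minus_hurwitz_def)

lemma hcoeff_one: "hcoeff (1 :: 'a::comm_ring_1 hurwitz) n = (if n = 0 then 1 else 0)"
  by (simp add: one_hurwitz_def)

lemma hcoeff_mult:
  "hcoeff (a * b) n = (\<Sum>i=0..n. of_nat (n choose i) * (hcoeff a i * hcoeff b (n - i)))"
  for a b :: "'a::comm_ring_1 hurwitz"
  by (simp add: times_hurwitz_def)

lemma hcoeff_sum [simp]: "hcoeff (sum g A) n = (\<Sum>x\<in>A. hcoeff (g x :: 'a::comm_ring_1 hurwitz) n)"
  by (induction A rule: infinite_finite_induct) auto

lemma hcoeff_of_nat_mult [simp]: "hcoeff (of_nat k * a) n = of_nat k * hcoeff a n"
  for a :: "'a::comm_ring_1 hurwitz"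
  by (induction k) (simp_all add: distrib_right)

lemma hcoeff_of_int_mult [simp]: "hcoeff (of_int l * a) n = of_int l * hcoeff a n"
  for a :: "'a::comm_ring_1 hurwitz"
proof (cases l)
  case (neg k)
  have "hcoeff (- b) n = - hcoeff b n" for b :: "'a hurwitz" by (simp add: uminus_hurwitz_def)
  with neg show ?thesis by (simp del: of_nat_Suc)
qed simp

text \<open>The divided power (x t)^[i] = x^i t^[i]. Its coefficient at i is x^i without a
  factorial, so the symbol \<open>[x]_p\<close> will yield a p-th power.\<close>

definition dpow :: "'a::comm_ring_1 \<Rightarrow> nat \<Rightarrow> 'a hurwitz" where
  "dpow x i = Hurwitz (\<lambda>n. if n = i then x ^ i else 0)"

lemma hcoeff_dpow [simp]: "hcoeff (dpow x i) n = (if n = i then x ^ i else 0)"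
  by (simp add: dpow_def)

lemma hcoeff_dpow_mult:
  "hcoeff (dpow x i * a) n = (if i \<le> n then of_nat (n choose i) * (x ^ i * hcoeff a (n - i)) else 0)"
  by (simp add: hcoeff_mult if_distrib[of "\<lambda>y. y * _"] if_distrib[of "\<lambda>y. _ * y"] cong: if_cong)

lemma dpow_0: "dpow x 0 = 1"
  by (rule hurwitz_eqI) (simp add: hcoeff_one)

lemma dpow_mult: "dpow x n * dpow x k = of_nat ((n + k) choose n) * dpow x (n + k)"
  by (rule hurwitz_eqI) (auto simp: hcoeff_dpow_mult power_add)

lemma dpow_add: "dpow (x + y) n = (\<Sum>i\<le>n. dpow x i * dpow y (n - i))"
proof (rule hurwitz_eqI)
  fix k
  show "hcoeff (dpow (x + y) n) k = hcoeff (\<Sum>i\<le>n. dpow x i * dpow y (n - i)) k"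
  proof (cases "k = n")
    case True
    then show ?thesis by (simp add: hcoeff_dpow_mult binomial_ring mult.assoc)
  next
    case False
    then have "hcoeff (dpow x i * dpow y (n - i)) k = 0" if "i \<le> n" for i
      using that by (auto simp: hcoeff_dpow_mult)
    with False show ?thesis by simp
  qed
qed

lemma dpow_of_int_mult: "dpow (of_int l * x) n = of_int (l ^ n) * dpow x n"
  by (rule hurwitz_eqI) (simp only: hcoeff_dpow hcoeff_of_int_mult, simp add: power_mult_distrib)


section \<open>The divided power algebra\<close>

text \<open>Makes every commutative ring type a module over the integers, so that spans and
  subspaces express generated and arbitrary additive subgroups.\<close>

interpretation zmod: module "\<lambda>(n::int) (x::'r::comm_ring_1). of_int n * x"
  by unfold_locales (simp_all add: algebra_simps)

lemma zmod_subspaceI: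
  fixes S :: "'r::comm_ring_1 set"
  assumes "0 \<in> S" and diff: "\<And>x y. x \<in> S \<Longrightarrow> y \<in> S \<Longrightarrow> x - y \<in> S"
  shows "zmod.subspace S"
proof (rule zmod.subspaceI)
  have neg: "- x \<in> S" if "x \<in> S" for x using diff[OF assms(1) that] by simp
  show add: "x + y \<in> S" if "x \<in> S" "y \<in> S" for x y using diff[OF that(1) neg[OF that(2)]] by simp
  fix l :: int and x assume x: "x \<in> S"
  have nat: "of_nat n * x \<in> S" for n
    by (induction n) (auto simp: distrib_right assms(1) intro: add x)
  show "of_int l * x \<in> S" by (cases l) (auto simp del: of_nat_Suc intro: nat neg)
qed (rule assms(1))

locale dp = cring M for M (structure)
begin

section \<open>Calculation with representatives modulo the defining ideal\<close>

abbreviation "\<R> \<equiv> dp_poly_ring M"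
abbreviation "\<J> \<equiv> dp_ideal M"
abbreviation "\<P> \<equiv> carrier (dp_poly_ring M)"

lemma \<P>_iff: "P \<in> \<P> \<longleftrightarrow> (\<forall>\<mu>\<in>Poly_Mapping.keys P. Poly_Mapping.keys \<mu> \<subseteq> carrier M \<times> UNIV)"
  unfolding dp_poly_ring_def by (simp add: subset_iff mem_Times_iff) (metis fst_conv prod.collapse)

lemma \<P>_0 [simp, intro]: "0 \<in> \<P>" and \<P>_1 [simp, intro]: "1 \<in> \<P>"
  by (auto simp: \<P>_iff)

lemma \<P>_diff [intro]: "P \<in> \<P> \<Longrightarrow> Q \<in> \<P> \<Longrightarrow> P - Q \<in> \<P>"
  unfolding \<P>_iff using keys_diff[of P Q] by blast

lemma \<P>_mult [intro]: "P \<in> \<P> \<Longrightarrow> Q \<in> \<P> \<Longrightarrow> P * Q \<in> \<P>"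
proof (unfold \<P>_iff, rule ballI)
  fix \<mu> assume P: "\<forall>\<mu>\<in>Poly_Mapping.keys P. Poly_Mapping.keys \<mu> \<subseteq> carrier M \<times> UNIV"
    and Q: "\<forall>\<mu>\<in>Poly_Mapping.keys Q. Poly_Mapping.keys \<mu> \<subseteq> carrier M \<times> UNIV"
    and "\<mu> \<in> Poly_Mapping.keys (P * Q)"
  then obtain \<alpha> \<beta> where "\<mu> = \<alpha> + \<beta>" "\<alpha> \<in> Poly_Mapping.keys P" "\<beta> \<in> Poly_Mapping.keys Q"
    using keys_mult[of P Q] by auto
  then show "Poly_Mapping.keys \<mu> \<subseteq> carrier M \<times> UNIV"
    using P Q Poly_Mapping.keys_add[of \<alpha> \<beta>] by blast
qed

lemma \<P>_var [simp]: "poly_var (x, i) \<in> \<P> \<longleftrightarrow> x \<in> carrier M"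
  by (auto simp: \<P>_iff poly_var_def)

lemma \<P>_add [intro]: "P \<in> \<P> \<Longrightarrow> Q \<in> \<P> \<Longrightarrow> P + Q \<in> \<P>"
  using \<P>_diff[of P "0 - Q"] \<P>_diff[of 0 Q] by simp

lemma \<P>_uminus [intro]: "P \<in> \<P> \<Longrightarrow> - P \<in> \<P>"
  using \<P>_diff[of 0 P] by simp

lemma subspace_\<P>: "zmod.subspace \<P>"
  by (rule zmod_subspaceI) auto

lemma \<P>_of_int [intro]: "P \<in> \<P> \<Longrightarrow> of_int l * P \<in> \<P>" and \<P>_of_nat [intro]: "P \<in> \<P> \<Longrightarrow> of_nat n * P \<in> \<P>"
  using zmod.subspace_scale[OF subspace_\<P>, of P l] zmod.subspace_scale[OF subspace_\<P>, of P "int n"]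
  by auto

lemma \<P>_power [intro]: "P \<in> \<P> \<Longrightarrow> P ^ n \<in> \<P>"
  by (induction n) auto

lemma \<P>_sum [intro]: "(\<And>x. x \<in> A \<Longrightarrow> g x \<in> \<P>) \<Longrightarrow> sum g A \<in> \<P>"
  by (rule zmod.subspace_sum[OF subspace_\<P>])

lemma \<R>_simps:
  "P \<otimes>\<^bsub>\<R>\<^esub> Q = P * Q" "P \<oplus>\<^bsub>\<R>\<^esub> Q = P + Q" "\<one>\<^bsub>\<R>\<^esub> = 1" "\<zero>\<^bsub>\<R>\<^esub> = 0"
  by (simp_all add: dp_poly_ring_def)

sublocale \<R>: cring "dp_poly_ring M"
proof (rule cringI)
  show "abelian_group \<R>"
  proof (rule abelian_groupI)
    fix P assume "P \<in> \<P>"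
    then show "\<exists>Q\<in>\<P>. Q \<oplus>\<^bsub>\<R>\<^esub> P = \<zero>\<^bsub>\<R>\<^esub>"
      by (intro bexI[of _ "0 - P"]) (auto simp: \<R>_simps)
  qed (auto simp: \<R>_simps algebra_simps)
  show "comm_monoid \<R>" by (rule comm_monoidI) (auto simp: \<R>_simps algebra_simps)
qed (auto simp: \<R>_simps algebra_simps)

lemma \<R>_uminus: "P \<in> \<P> \<Longrightarrow> \<ominus>\<^bsub>\<R>\<^esub> P = 0 - P"
  by (rule \<R>.minus_equality) (auto simp: \<R>_simps)

lemma \<R>_minus: "P \<in> \<P> \<Longrightarrow> Q \<in> \<P> \<Longrightarrow> P \<ominus>\<^bsub>\<R>\<^esub> Q = P - Q"
  by (simp add: a_minus_def \<R>_uminus \<R>_simps)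

lemma ideal_\<R>I:
  assumes "K \<subseteq> \<P>" "0 \<in> K" "\<And>P Q. P \<in> K \<Longrightarrow> Q \<in> K \<Longrightarrow> P - Q \<in> K"
    "\<And>P Q. P \<in> \<P> \<Longrightarrow> Q \<in> K \<Longrightarrow> P * Q \<in> K"
  shows "ideal K \<R>"
proof (rule idealI)
  have neg: "0 - P \<in> K" if "P \<in> K" for P using assms(2,3) that by blast
  show "subgroup K (add_monoid \<R>)"
  proof
    fix P assume P: "P \<in> K"
    then have "inv\<^bsub>add_monoid \<R>\<^esub> P = 0 - P"
      using \<R>_uminus[of P] assms(1) by (auto simp: a_inv_def)
    then show "inv\<^bsub>add_monoid \<R>\<^esub> P \<in> K" using neg[OF P] by simp
    fix Q assume Q: "Q \<in> K"
    show "P \<otimes>\<^bsub>add_monoid \<R>\<^esub> Q \<in> K" using assms(3)[OF P neg[OF Q]] by (simp add: \<R>_simps)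
  qed (use assms(1,2) in \<open>auto simp: \<R>_simps\<close>)
qed (auto simp: \<R>_simps intro: \<R>.ring_axioms assms(4), metis assms(4) mult.commute)

lemma relations_subset: "dp_relations M \<subseteq> \<P>"
proof -
  have "[l] \<cdot> x \<in> carrier M" if "x \<in> carrier M" for l :: int and x
    using that by (rule add.int_pow_closed)
  then show ?thesis
    unfolding dp_relations_def by (intro Un_least subsetI) (auto intro!: \<P>_diff \<P>_mult \<P>_sum \<P>_of_nat \<P>_of_int simp del: of_int_power)
qed

sublocale \<J>: ideal "dp_ideal M" "dp_poly_ring M"
  unfolding dp_ideal_def by (rule \<R>.genideal_ideal[OF relations_subset])

lemma relations_subset_\<J>: "dp_relations M \<subseteq> \<J>"
  unfolding dp_ideal_def by (rule \<R>.genideal_self[OF relations_subset])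

lemma \<J>_subset: "\<J> \<subseteq> \<P>"
  using \<J>.a_subset .

lemma \<J>_0 [simp, intro]: "0 \<in> \<J>"
  using \<J>.zero_closed by (simp add: \<R>_simps)

lemma \<J>_diff: "P \<in> \<J> \<Longrightarrow> Q \<in> \<J> \<Longrightarrow> P - Q \<in> \<J>"
  using \<J>.a_closed[of P "0 - Q"] \<J>.a_inv_closed[of Q] \<J>_subset by (auto simp: \<R>_simps \<R>_uminus)

lemma subspace_\<J>: "zmod.subspace \<J>"
  by (rule zmod_subspaceI) (auto intro: \<J>_diff)

lemma \<J>_add: "P \<in> \<J> \<Longrightarrow> Q \<in> \<J> \<Longrightarrow> P + Q \<in> \<J>"
  by (rule zmod.subspace_add[OF subspace_\<J>])

lemma \<J>_neg: "P - Q \<in> \<J> \<Longrightarrow> Q - P \<in> \<J>"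
  using \<J>_diff[OF \<J>_0, of "P - Q"] by simp

lemma \<J>_trans: "P - Q \<in> \<J> \<Longrightarrow> Q - T \<in> \<J> \<Longrightarrow> P - T \<in> \<J>"
  using \<J>_add[of "P - Q" "Q - T"] by simp

lemma \<J>_mult: "P \<in> \<P> \<Longrightarrow> Q \<in> \<J> \<Longrightarrow> P * Q \<in> \<J>" "P \<in> \<P> \<Longrightarrow> Q \<in> \<J> \<Longrightarrow> Q * P \<in> \<J>"
  using \<J>.I_l_closed[of Q P] by (auto simp: \<R>_simps mult.commute)

lemma \<J>_sum: "(\<And>x. x \<in> A \<Longrightarrow> g x \<in> \<J>) \<Longrightarrow> sum g A \<in> \<J>"
  by (rule zmod.subspace_sum[OF subspace_\<J>])

lemma \<J>_mult_cong:
  assumes "P - P' \<in> \<J>" "Q - Q' \<in> \<J>" "P' \<in> \<P>" "Q \<in> \<P>"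
  shows "P * Q - P' * Q' \<in> \<J>"
proof -
  have "(P - P') * Q + P' * (Q - Q') \<in> \<J>" using assms by (intro \<J>_add \<J>_mult)
  then show ?thesis by (simp add: algebra_simps)
qed

lemma symbol_0: "x \<in> carrier M \<Longrightarrow> poly_var (x, 0) - 1 \<in> \<J>"
  by (rule subsetD[OF relations_subset_\<J>]) (auto simp: dp_relations_def)

lemma symbol_add:
  assumes "x \<in> carrier M" "y \<in> carrier M"
  shows "poly_var (x \<oplus> y, n) - (\<Sum>i\<le>n. poly_var (x, i) * poly_var (y, n - i)) \<in> \<J>"
  by (rule subsetD[OF relations_subset_\<J>]) (use assms in \<open>force simp: dp_relations_def\<close>)

lemma symbol_smult:
  fixes l :: int
  assumes "x \<in> carrier M"
  shows "poly_var ([l] \<cdot> x, n) - of_int (l ^ n) * poly_var (x, n) \<in> \<J>"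
  by (rule subsetD[OF relations_subset_\<J>]) (use assms in \<open>unfold dp_relations_def, blast\<close>)

lemma symbol_mult:
  assumes "x \<in> carrier M"
  shows "poly_var (x, n) * poly_var (x, k) - of_nat ((n + k) choose n) * poly_var (x, n + k) \<in> \<J>"
  by (rule subsetD[OF relations_subset_\<J>]) (use assms in \<open>unfold dp_relations_def, blast\<close>)

lemma symbol_zero: "n > 0 \<Longrightarrow> poly_var (\<zero>, n) \<in> \<J>"
  using symbol_smult[of "\<zero>" 0 n] by (simp add: power_0_left)


section \<open>Polarization and products of symbols of degree one\<close>

definition powers_span :: "nat \<Rightarrow> ('a \<times> nat) int_poly set" where
  "powers_span n = zmod.span (\<J> \<union> {poly_var (x, n) | x. x \<in> carrier M})"

definition linear_products :: "nat \<Rightarrow> ('a \<times> nat) int_poly set" where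
  "linear_products n = {prod_list (map (\<lambda>x. poly_var (x, 1)) xs) | xs. set xs \<subseteq> carrier M \<and> length xs = n}"

text \<open>Like \<open>powers_span\<close>, it contains \<open>\<J>\<close>, so membership depends
  only on the class in the divided power algebra while all calculations stay in the polynomial
  ring.\<close>

definition linear_span :: "nat \<Rightarrow> ('a \<times> nat) int_poly set" where
  "linear_span n = zmod.span (\<J> \<union> linear_products n)"

text \<open>
  The exponential sequences \<open>E x = \<Sum>\<^sub>i [x]\<^sub>i T\<^sup>i\<close> satisfy \<open>E (x + y) = E x E y\<close>, so the
  additive group spanned by them is a ring containing \<open>\<Prod>\<^sub>i (E x\<^sub>i - 1)\<close>, whose lowest
  coefficient is \<open>\<Prod>\<^sub>i [x\<^sub>i]\<^sub>1\<close>.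
\<close>

lemma linear_products_subset_powers_span: "linear_products n \<subseteq> powers_span n" if "n > 0"
proof
  fix P assume "P \<in> linear_products n"
  then obtain xs where P: "P = prod_list (map (\<lambda>x. poly_var (x, 1)) xs)"
    and xs: "set xs \<subseteq> carrier M" "length xs = n"
    by (auto simp: linear_products_def)
  \<comment> \<open>The constant coefficient is 1 itself and not \<open>[x]_0\<close>, which is 1
    only modulo \<open>\<J>\<close>. This makes \<open>E x - 1\<close> exactly divisible by
    \<open>fps_X\<close>.\<close>
  define E where "E = (\<lambda>x::'a. Abs_fps (\<lambda>i. if i = 0 then 1 else poly_var (x, i)))"
  define \<JJ> where "\<JJ> = {F. \<forall>i. fps_nth F i \<in> \<J>}"
  define \<A> where "\<A> = zmod.span (\<JJ> \<union> E ` carrier M)"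
  have E_nth: "fps_nth (E x) i \<in> \<P>" if "x \<in> carrier M" for x i
    using that by (simp add: E_def)
  have E_cong: "fps_nth (E x) i - poly_var (x, i) \<in> \<J>" if "x \<in> carrier M" for x i
    using symbol_0[OF that] by (auto simp: E_def intro: \<J>_neg)
  have E_add: "E x * E y - E (x \<oplus> y) \<in> \<JJ>" if x: "x \<in> carrier M" and y: "y \<in> carrier M" for x y
    unfolding \<JJ>_def
  proof (intro CollectI allI)
    fix n
    have "(\<Sum>i\<le>n. fps_nth (E x) i * fps_nth (E y) (n - i) - poly_var (x, i) * poly_var (y, n - i)) \<in> \<J>"
      by (intro \<J>_sum \<J>_mult_cong E_cong x y E_nth) (use x in simp)
    then have "fps_nth (E x * E y) n - (\<Sum>i\<le>n. poly_var (x, i) * poly_var (y, n - i)) \<in> \<J>"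
      by (simp add: fps_mult_nth sum_subtractf atLeast0AtMost)
    moreover have "(\<Sum>i\<le>n. poly_var (x, i) * poly_var (y, n - i)) - poly_var (x \<oplus> y, n) \<in> \<J>"
      by (rule \<J>_neg[OF symbol_add[OF x y]])
    moreover have "poly_var (x \<oplus> y, n) - fps_nth (E (x \<oplus> y)) n \<in> \<J>"
      by (rule \<J>_neg[OF E_cong]) (use x y in simp)
    ultimately show "fps_nth (E x * E y - E (x \<oplus> y)) n \<in> \<J>"
      unfolding fps_sub_nth using \<J>_trans by blast
  qed
  have \<A>_E: "E x \<in> \<A>" if "x \<in> carrier M" for x
    unfolding \<A>_def using that by (intro zmod.span_base) auto
  have \<A>_\<JJ>: "F \<in> \<A>" if "F \<in> \<JJ>" for F
    unfolding \<A>_def using that by (intro zmod.span_base) auto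
  have \<A>_diff: "F - G \<in> \<A>" if "F \<in> \<A>" "G \<in> \<A>" for F G
    using that unfolding \<A>_def by (rule zmod.span_diff)
  have \<A>_0: "0 \<in> \<A>" unfolding \<A>_def by (rule zmod.span_zero)
  have \<A>_mult: "F * E y \<in> \<A>" if F: "F \<in> \<A>" and y: "y \<in> carrier M" for F y
    using F[unfolded \<A>_def]
  proof (induction rule: zmod.span_induct)
    case base
    show ?case
      unfolding \<A>_def by (rule zmod_subspaceI)
        (auto simp: left_diff_distrib zmod.span_zero intro: zmod.span_diff)
  next
    case (step F)
    show ?case
    proof (cases "F \<in> \<JJ>")
      case True
      have "fps_nth (F * E y) i \<in> \<J>" for i
        unfolding fps_mult_nth using True by (intro \<J>_sum \<J>_mult E_nth y) (auto simp: \<JJ>_def)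
      then show ?thesis by (intro \<A>_\<JJ>) (simp add: \<JJ>_def)
    next
      case False
      then obtain x where x: "x \<in> carrier M" "F = E x" using step by auto
      then have "(E x * E y - E (x \<oplus> y)) - (0 - E (x \<oplus> y)) \<in> \<A>"
        by (intro \<A>_diff[OF \<A>_\<JJ>[OF E_add] \<A>_diff[OF \<A>_0 \<A>_E]] y) (simp_all add: y)
      then show ?thesis by (simp add: x)
    qed
  qed
  have "fps_nth (1 - E \<zero>) i \<in> \<J>" for i
    using \<J>_diff[OF \<J>_0 symbol_zero[of i]] by (cases "i = 0") (simp_all add: E_def)
  then have "1 - E \<zero> \<in> \<A>" by (intro \<A>_\<JJ>) (simp add: \<JJ>_def)
  then have "(1 - E \<zero>) - (0 - E \<zero>) \<in> \<A>"
    by (rule \<A>_diff[OF _ \<A>_diff[OF \<A>_0 \<A>_E]]) simp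
  then have \<A>_1: "1 \<in> \<A>" by simp
  have "prod_list (map (\<lambda>x. E x - 1) ys) \<in> \<A>" if "set ys \<subseteq> carrier M" for ys
    using that
  proof (induction ys)
    case (Cons y ys)
    then have "prod_list (map (\<lambda>x. E x - 1) ys) * E y - prod_list (map (\<lambda>x. E x - 1) ys) \<in> \<A>"
      by (intro \<A>_diff \<A>_mult) auto
    then show ?case by (simp add: algebra_simps)
  qed (simp add: \<A>_1)
  then have "prod_list (map (\<lambda>x. E x - 1) xs) \<in> zmod.span (\<JJ> \<union> E ` carrier M)"
    using xs \<A>_def by simp
  \<comment> \<open>Taking the n-th coefficient is additive, sends \<open>\<JJ>\<close> into
    \<open>\<J>\<close> and \<open>E x\<close> to \<open>[x]_n\<close>; the latter uses n >
    0.\<close>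
  then have "fps_nth (prod_list (map (\<lambda>x. E x - 1) xs)) n \<in> powers_span n"
  proof (induction rule: zmod.span_induct)
    case base
    show ?case
      unfolding powers_span_def by (rule zmod_subspaceI)
        (auto simp: zmod.span_zero intro: zmod.span_diff)
  next
    case (step F)
    then show ?case
      using \<open>n > 0\<close> unfolding powers_span_def
      by (intro zmod.span_base) (auto simp: \<JJ>_def E_def)
  qed
  moreover have "prod_list (map (\<lambda>x. E x - 1) ys)
      = fps_X ^ length ys * prod_list (map (\<lambda>x. Abs_fps (\<lambda>i. poly_var (x, Suc i))) ys)" for ys :: "'a list"
  proof (induction ys)
    case (Cons y ys)
    have "E y - 1 = fps_X * Abs_fps (\<lambda>i. poly_var (y, Suc i))"
      by (rule fps_ext) (simp add: E_def)
    with Cons show ?case by (simp add: mult_ac)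
  qed simp
  moreover have "fps_nth (prod_list (map (\<lambda>x. Abs_fps (\<lambda>i. poly_var (x, Suc i))) ys)) 0
      = prod_list (map (\<lambda>x. poly_var (x, 1)) ys)" for ys :: "'a list"
    by (induction ys) simp_all
  ultimately show "P \<in> powers_span n"
    using xs by (simp add: P fps_X_power_mult_nth)
qed

lemma linear_span_subset_powers_span: "n > 0 \<Longrightarrow> linear_span n \<subseteq> powers_span n"
  using linear_products_subset_powers_span[of n] zmod.span_superset[of "\<J> \<union> {poly_var (x, n) | x. x \<in> carrier M}"]
  unfolding linear_span_def powers_span_def
  by (intro zmod.span_minimal zmod.subspace_span) auto

lemma linear_products_subset: "linear_products n \<subseteq> \<P>"
proof -
  have "prod_list (map (\<lambda>x. poly_var (x, 1)) xs) \<in> \<P>" if "set xs \<subseteq> carrier M" for xs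
    using that by (induction xs) auto
  then show ?thesis by (auto simp: linear_products_def)
qed

lemma linear_span_base: "P \<in> linear_products n \<Longrightarrow> P \<in> linear_span n" "P \<in> \<J> \<Longrightarrow> P \<in> linear_span n"
  unfolding linear_span_def by (auto intro: zmod.span_base)

lemma linear_span_1: "1 \<in> linear_span 0"
  by (rule linear_span_base) (auto simp: linear_products_def intro: exI[of _ "[]"])

lemma linear_span_cong: "P - Q \<in> \<J> \<Longrightarrow> Q \<in> linear_span n \<Longrightarrow> P \<in> linear_span n"
  using zmod.span_add[of "P - Q" "\<J> \<union> linear_products n" Q] linear_span_base(2)[of "P - Q" n]
  by (simp add: linear_span_def)

lemma linear_span_of_int: "P \<in> linear_span n \<Longrightarrow> of_int l * P \<in> linear_span n"
  unfolding linear_span_def by (rule zmod.span_scale)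

lemma linear_span_mult:
  assumes "P \<in> linear_span m" "Q \<in> linear_span n"
  shows "P * Q \<in> linear_span (m + n)"
  using assms(1)[unfolded linear_span_def]
proof (induction rule: zmod.span_induct)
  case base
  show ?case
    by (rule zmod_subspaceI)
      (auto simp: left_diff_distrib linear_span_def zmod.span_zero intro: zmod.span_diff)
next
  case (step P)
  then have P: "P \<in> \<P>" using \<J>_subset linear_products_subset by blast
  show ?case
    using assms(2)[unfolded linear_span_def]
  proof (induction rule: zmod.span_induct)
    case base
    show ?case
      by (rule zmod_subspaceI)
        (auto simp: right_diff_distrib linear_span_def zmod.span_zero intro: zmod.span_diff)
  next
    case (step Q)
    then have Q: "Q \<in> \<P>" using \<J>_subset linear_products_subset by blast
    consider "P \<in> \<J>" | "Q \<in> \<J>" | "P \<in> linear_products m" "Q \<in> linear_products n"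
      using step \<open>P \<in> \<J> \<union> linear_products m\<close> by blast
    then show ?case
    proof cases
      case 3
      then obtain xs ys where "P = prod_list (map (\<lambda>x. poly_var (x, 1)) xs)" "set xs \<subseteq> carrier M" "length xs = m"
        "Q = prod_list (map (\<lambda>x. poly_var (x, 1)) ys)" "set ys \<subseteq> carrier M" "length ys = n"
        by (auto simp: linear_products_def)
      then have "P * Q \<in> linear_products (m + n)"
        unfolding linear_products_def by (intro CollectI exI[of _ "xs @ ys"]) simp
      then show ?thesis by (rule linear_span_base)
    qed (use P Q in \<open>auto intro: linear_span_base \<J>_mult\<close>)
  qed
qed

lemma linear_span_power: "P \<in> linear_span m \<Longrightarrow> P ^ n \<in> linear_span (n * m)"
  by (induction n) (auto intro: linear_span_1 linear_span_mult)

lemma symbol_1_power: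
  assumes "x \<in> carrier M"
  shows "poly_var (x, 1) ^ i - of_nat (fact i) * poly_var (x, i) \<in> \<J>"
proof (induction i)
  case 0
  show ?case using \<J>_neg[OF symbol_0[OF assms]] by simp
next
  case (Suc i)
  have "poly_var (x, 1) * (poly_var (x, 1) ^ i - of_nat (fact i) * poly_var (x, i)) \<in> \<J>"
    using Suc assms by (intro \<J>_mult) auto
  moreover have "of_nat (fact i) * (poly_var (x, 1) * poly_var (x, i) - of_nat ((1 + i) choose 1) * poly_var (x, 1 + i)) \<in> \<J>"
    by (intro \<J>_mult symbol_mult assms) (metis \<P>_of_nat \<P>_1 mult.right_neutral)
  ultimately have "poly_var (x, 1) * (poly_var (x, 1) ^ i - of_nat (fact i) * poly_var (x, i)) +
     of_nat (fact i) * (poly_var (x, 1) * poly_var (x, i) - of_nat ((1 + i) choose 1) * poly_var (x, 1 + i)) \<in> \<J>"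
    by (rule \<J>_add)
  then show ?case by (simp add: algebra_simps)
qed

text \<open>Below the degree \<open>p\<close> the factorial in \<open>i! [x]\<^sub>i = [x]\<^sub>1\<^sup>i\<close> is invertible modulo the \<open>p\<close>-power torsion.\<close>

lemma symbol_in_linear_span:
  assumes p: "prime p" and x: "x \<in> carrier M" and torsion: "[int (p ^ m)] \<cdot> x = \<zero>" and "i < p"
  shows "poly_var (x, i) \<in> linear_span i"
proof (cases "i = 0")
  case True
  then show ?thesis using symbol_0[OF x] linear_span_1 by (auto intro: linear_span_cong)
next
  case False
  \<comment> \<open>This scalar annihilates \<open>[x]_i\<close> modulo \<open>\<J>\<close>:
    multiplying x by p^m gives zero, multiplies \<open>[x]_i\<close> by (p^m)^i, and
    \<open>[0]_i\<close> vanishes for i > 0. It is coprime to i!, so a Bezout relation recovers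
    \<open>[x]_i\<close>.\<close>
  let ?t = "int (p ^ m) ^ i"
  have "coprime p (fact i)"
    using p \<open>i < p\<close> by (intro prime_imp_coprime) (simp_all add: prime_dvd_fact_iff)
  then have "coprime (fact i) ((p ^ m) ^ i)" by (metis coprime_commute coprime_power_right_iff)
  then have "coprime (int (fact i)) (int ((p ^ m) ^ i))" by (simp only: coprime_int_iff)
  then have "coprime (int (fact i)) ?t" by simp
  then obtain u v where uv: "u * int (fact i) + v * ?t = 1"
    using bezout_int by (metis coprime_iff_gcd_eq_1)
  have "poly_var (x, 1) \<in> linear_products 1"
    unfolding linear_products_def using x by (intro CollectI exI[of _ "[x]"]) simp
  then have "poly_var (x, 1) ^ i \<in> linear_span (i * 1)"
    by (intro linear_span_power linear_span_base)
  then have fact: "of_nat (fact i) * poly_var (x, i) \<in> linear_span i"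
    using \<J>_neg[OF symbol_1_power[OF x, of i]] by (auto intro: linear_span_cong)
  have "poly_var (\<zero>, i) - of_int ?t * poly_var (x, i) \<in> \<J>"
    using symbol_smult[OF x, of "int (p ^ m)" i] torsion by simp
  from \<J>_diff[OF symbol_zero[of i] this] False have "of_int ?t * poly_var (x, i) \<in> \<J>" by simp
  then have tor: "of_int ?t * poly_var (x, i) \<in> linear_span i" by (rule linear_span_base)
  have "of_int u * (of_nat (fact i) * poly_var (x, i)) + of_int v * (of_int ?t * poly_var (x, i)) \<in> linear_span i"
    using linear_span_of_int[OF fact, of u] linear_span_of_int[OF tor, of v]
    unfolding linear_span_def by (rule zmod.span_add)
  also have "of_int u * (of_nat (fact i) * poly_var (x, i)) + of_int v * (of_int ?t * poly_var (x, i))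
      = of_int (u * int (fact i) + v * ?t) * poly_var (x, i)"
    by (simp only: of_int_add of_int_mult of_int_of_nat_eq distrib_right mult.assoc)
  finally show ?thesis unfolding uv by simp
qed

section \<open>Weights and the monomials of degree p\<close>

definition homogeneous :: "nat \<Rightarrow> ('a \<times> nat) int_poly set" where
  "homogeneous j = {P \<in> \<P>. \<forall>\<mu>\<in>Poly_Mapping.keys P. dp_weight \<mu> = j}"

lemma homogeneous_subset: "homogeneous j \<subseteq> \<P>"
  by (auto simp: homogeneous_def)

lemma homogeneous_diff: "P \<in> homogeneous j \<Longrightarrow> Q \<in> homogeneous j \<Longrightarrow> P - Q \<in> homogeneous j"
  unfolding homogeneous_def using keys_diff[of P Q] by blast

lemma subspace_homogeneous: "zmod.subspace (homogeneous j)"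
proof (rule zmod_subspaceI)
  show "0 \<in> homogeneous j" by (simp add: homogeneous_def)
qed (rule homogeneous_diff)

lemma dp_weight_add: "dp_weight (\<mu> + \<nu>) = dp_weight \<mu> + dp_weight \<nu>"
proof -
  have *: "dp_weight \<alpha> = (\<Sum>v\<in>S. Poly_Mapping.lookup \<alpha> v * snd v)"
    if "finite S" "Poly_Mapping.keys \<alpha> \<subseteq> S" for \<alpha> :: "'x \<times> nat \<Rightarrow>\<^sub>0 nat" and S
    unfolding dp_weight_def using that by (intro sum.mono_neutral_left) (auto simp: in_keys_iff)
  let ?S = "Poly_Mapping.keys \<mu> \<union> Poly_Mapping.keys \<nu>"
  have "dp_weight (\<mu> + \<nu>) = (\<Sum>v\<in>?S. Poly_Mapping.lookup (\<mu> + \<nu>) v * snd v)"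
    by (intro * Poly_Mapping.keys_add) simp
  moreover have "dp_weight \<mu> = (\<Sum>v\<in>?S. Poly_Mapping.lookup \<mu> v * snd v)"
    "dp_weight \<nu> = (\<Sum>v\<in>?S. Poly_Mapping.lookup \<nu> v * snd v)"
    by (rule *; simp)+
  ultimately show ?thesis by (simp only: lookup_add distrib_right sum.distrib)
qed

lemma homogeneous_mult:
  assumes "P \<in> homogeneous i" "Q \<in> homogeneous j"
  shows "P * Q \<in> homogeneous (i + j)"
proof -
  have "dp_weight \<mu> = i + j" if \<mu>: "\<mu> \<in> Poly_Mapping.keys (P * Q)" for \<mu>
  proof -
    obtain \<alpha> \<beta> where "\<mu> = \<alpha> + \<beta>" "\<alpha> \<in> Poly_Mapping.keys P" "\<beta> \<in> Poly_Mapping.keys Q"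
      using \<mu> keys_mult[of P Q] by blast
    then show ?thesis using assms by (auto simp: homogeneous_def dp_weight_add)
  qed
  then show ?thesis using assms by (auto simp: homogeneous_def)
qed

lemma homogeneous_var: "x \<in> carrier M \<Longrightarrow> poly_var (x, i) \<in> homogeneous i"
  using \<P>_var[of x i] by (simp add: homogeneous_def) (simp add: poly_var_def dp_weight_def)

text \<open>A factor \<open>[x]_i\<close> with i at least p uses up the whole weight: then i = p,
  its exponent is 1, and all other factors have index 0 and equal 1 modulo \<open>\<J>\<close>.
  Otherwise every index is below p and every factor lies in a \<open>linear_span\<close>.\<close>

lemma monomial_cases:
  assumes p: "prime p" and torsion: "\<And>x. x \<in> carrier M \<Longrightarrow> [int (p ^ m)] \<cdot> x = \<zero>"
    and \<mu>: "Poly_Mapping.keys \<mu> \<subseteq> carrier M \<times> UNIV" "dp_weight \<mu> = p"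
  shows "Poly_Mapping.single \<mu> 1 \<in> linear_span p
    \<or> (\<exists>x\<in>carrier M. Poly_Mapping.single \<mu> 1 - poly_var (x, p) \<in> \<J>)"
proof (cases "\<exists>v\<in>Poly_Mapping.keys \<mu>. snd v \<ge> p")
  case True
  then obtain x i where v: "(x, i) \<in> Poly_Mapping.keys \<mu>" "i \<ge> p" by auto
  let ?l = "Poly_Mapping.lookup \<mu>" and ?S = "Poly_Mapping.keys \<mu> - {(x, i)}"
  have l: "?l (x, i) > 0" using v(1) by (simp add: in_keys_iff)
  have p0: "p > 0" using p by (rule prime_gt_0_nat)
  have weight: "?l (x, i) * i + (\<Sum>w\<in>?S. ?l w * snd w) = p"
    using \<mu>(2) sum.remove[OF finite_keys v(1), of "\<lambda>w. ?l w * snd w"] by (simp add: dp_weight_def)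
  have "i \<le> ?l (x, i) * i" using l by simp
  then have i: "i = p" and rest: "(\<Sum>w\<in>?S. ?l w * snd w) = 0" and "?l (x, i) * i = i"
    using weight v(2) by linarith+
  then have one: "?l (x, i) = 1" using p0 by simp
  have "snd w = 0" if "w \<in> ?S" for w
    using rest that by (simp add: sum_eq_0_iff in_keys_iff)
  then have S: "w = (fst w, 0)" "fst w \<in> carrier M" if "w \<in> ?S" for w
    using that \<mu>(1) by (auto simp: prod_eq_iff)
  have "(\<Prod>w\<in>T. poly_var w ^ ?l w) - 1 \<in> \<J> \<and> (\<Prod>w\<in>T. poly_var w ^ ?l w) \<in> \<P>" if "finite T" "T \<subseteq> ?S" for T
    using that
  proof (induction T rule: finite_induct)
    case (insert w T)
    obtain y where w: "w = (y, 0)" "y \<in> carrier M" using S[of w] insert.prems by auto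
    have "poly_var w ^ k - 1 \<in> \<J>" for k
    proof (induction k)
      case (Suc k)
      have "poly_var w * poly_var w ^ k - 1 * 1 \<in> \<J>"
        using Suc w symbol_0[of y] by (intro \<J>_mult_cong) auto
      then show ?case by simp
    qed simp
    then have "poly_var w ^ ?l w * (\<Prod>w\<in>T. poly_var w ^ ?l w) - 1 * 1 \<in> \<J>"
      using insert by (intro \<J>_mult_cong) auto
    moreover have "poly_var w \<in> \<P>" using w by simp
    ultimately show ?case using insert by auto
  qed simp
  from this[of ?S] have "(\<Prod>w\<in>?S. poly_var w ^ ?l w) - 1 \<in> \<J>" by simp
  moreover have x: "x \<in> carrier M" using v(1) \<mu>(1) by auto
  ultimately have "poly_var (x, i) * ((\<Prod>w\<in>?S. poly_var w ^ ?l w) - 1) \<in> \<J>"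
    by (intro \<J>_mult) auto
  moreover have "Poly_Mapping.single \<mu> 1 = poly_var (x, i) * (\<Prod>w\<in>?S. poly_var w ^ ?l w)"
    using prod.remove[OF finite_keys v(1), of "\<lambda>w. poly_var w ^ ?l w"] one by (simp add: monom_eq_prod_vars)
  ultimately have "Poly_Mapping.single \<mu> 1 - poly_var (x, p) \<in> \<J>"
    by (simp add: right_diff_distrib i)
  with x show ?thesis by blast
next
  case False
  have "(\<Prod>w\<in>T. poly_var w ^ Poly_Mapping.lookup \<mu> w) \<in> linear_span (\<Sum>w\<in>T. Poly_Mapping.lookup \<mu> w * snd w)"
    if "finite T" "T \<subseteq> Poly_Mapping.keys \<mu>" for T
    using that
  proof (induction T rule: finite_induct)
    case (insert w T)
    obtain x i where w: "w = (x, i)" "x \<in> carrier M" "i < p"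
      using insert.prems \<mu>(1) False by (cases w) force
    then have "poly_var w ^ Poly_Mapping.lookup \<mu> w \<in> linear_span (Poly_Mapping.lookup \<mu> w * snd w)"
      using symbol_in_linear_span[OF p _ torsion] by (auto intro: linear_span_power)
    then show ?case
      using insert by (auto intro!: linear_span_mult)
  qed (simp add: linear_span_1)
  from this[of "Poly_Mapping.keys \<mu>"] \<mu>(2) show ?thesis
    by (simp add: monom_eq_prod_vars dp_weight_def)
qed

text \<open>The induction principle for degree p. It is applied twice: with E =
  \<open>powers_span p\<close> for uniqueness of the power map, and with the polynomials having the
  two-term normal form modulo the relations.\<close>

lemma homogeneous_in_subspace:
  assumes p: "prime p" and torsion: "\<And>x. x \<in> carrier M \<Longrightarrow> [int (p ^ m)] \<cdot> x = \<zero>"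
    and E: "zmod.subspace E" "linear_span p \<subseteq> E" "\<And>x. x \<in> carrier M \<Longrightarrow> poly_var (x, p) \<in> E"
    and P: "P \<in> homogeneous p"
  shows "P \<in> E"
proof (rule frag_induction[of P "{\<mu>. Poly_Mapping.keys \<mu> \<subseteq> carrier M \<times> UNIV \<and> dp_weight \<mu> = p}"])
  show "Poly_Mapping.keys P \<subseteq> {\<mu>. Poly_Mapping.keys \<mu> \<subseteq> carrier M \<times> UNIV \<and> dp_weight \<mu> = p}"
    using P by (auto simp: homogeneous_def \<P>_iff)
  show "0 \<in> E" by (rule zmod.subspace_0[OF E(1)])
  show "A - B \<in> E" if "A \<in> E" "B \<in> E" for A B by (rule zmod.subspace_diff[OF E(1) that])
  fix \<mu> assume "\<mu> \<in> {\<mu>. Poly_Mapping.keys \<mu> \<subseteq> carrier M \<times> UNIV \<and> dp_weight \<mu> = p}"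
  then consider "frag_of \<mu> \<in> linear_span p" | x where "x \<in> carrier M" "frag_of \<mu> - poly_var (x, p) \<in> \<J>"
    using monomial_cases[OF p torsion, of \<mu>] by auto
  then show "frag_of \<mu> \<in> E"
  proof cases
    case 2
    then have "frag_of \<mu> - poly_var (x, p) \<in> E" using E(2) linear_span_base(2) by blast
    from zmod.subspace_add[OF E(1) this E(3)[OF 2(1)]] show ?thesis by simp
  qed (use E in blast)
qed

lemma homogeneous_subset_powers_span:
  assumes "prime p" "\<And>x. x \<in> carrier M \<Longrightarrow> [int (p ^ m)] \<cdot> x = \<zero>"
  shows "homogeneous p \<subseteq> powers_span p"
proof
  fix P assume P: "P \<in> homogeneous p"
  show "P \<in> powers_span p"
  proof (rule homogeneous_in_subspace[OF assms _ _ _ P])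
    show "linear_span p \<subseteq> powers_span p"
      by (intro linear_span_subset_powers_span prime_gt_0_nat assms)
    show "zmod.subspace (powers_span p)"
      unfolding powers_span_def by (rule zmod.subspace_span)
    show "poly_var (x, p) \<in> powers_span p" if "x \<in> carrier M" for x
      unfolding powers_span_def using that by (intro zmod.span_base) auto
  qed
qed


section \<open>The degree components as groups of classes\<close>

abbreviation cl :: "('a \<times> nat) int_poly \<Rightarrow> ('a \<times> nat) int_poly set" where
  "cl P \<equiv> \<J> +>\<^bsub>\<R>\<^esub> P"

abbreviation "\<Gamma> j \<equiv> dp_component M j"

lemma cl_eq_iff: "P \<in> \<P> \<Longrightarrow> Q \<in> \<P> \<Longrightarrow> cl P = cl Q \<longleftrightarrow> P - Q \<in> \<J>"
  using \<R>.quotient_eq_iff_same_a_r_cos[OF \<J>.ideal_axioms, of P Q] by (simp add: \<R>_minus)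

lemma carrier_component: "carrier (\<Gamma> j) = cl ` homogeneous j"
  by (auto simp: dp_component_def homogeneous_def)

lemma mult_component: "P \<in> \<P> \<Longrightarrow> Q \<in> \<P> \<Longrightarrow> cl P \<otimes>\<^bsub>\<Gamma> j\<^esub> cl Q = cl (P + Q)"
  using \<J>.a_rcos_sum[of P Q] by (simp add: dp_component_def dp_algebra_def FactRing_def \<R>_simps)

lemma one_component: "\<one>\<^bsub>\<Gamma> j\<^esub> = cl 0"
  using \<R>.a_coset_add_zero[OF \<J>_subset] by (simp add: dp_component_def dp_algebra_def FactRing_def \<R>_simps)

lemma homogeneous_in_\<P>: "P \<in> homogeneous j \<Longrightarrow> P \<in> \<P>"
  using homogeneous_subset by blast

lemmas homogeneous_closed = zmod.subspace_0[OF subspace_homogeneous]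
  zmod.subspace_add[OF subspace_homogeneous] zmod.subspace_neg[OF subspace_homogeneous]

sublocale \<Gamma>: group "dp_component M j" for j
proof (rule groupI)
  fix x assume "x \<in> carrier (\<Gamma> j)"
  then obtain P where "P \<in> homogeneous j" "x = cl P" by (auto simp: carrier_component)
  then show "\<exists>y\<in>carrier (\<Gamma> j). y \<otimes>\<^bsub>\<Gamma> j\<^esub> x = \<one>\<^bsub>\<Gamma> j\<^esub>"
    using homogeneous_closed(3)[of P j]
    by (intro bexI[of _ "cl (- P)"]) (auto simp: mult_component one_component carrier_component homogeneous_in_\<P>)
qed (auto simp: carrier_component mult_component one_component homogeneous_in_\<P> homogeneous_closed \<P>_add add.assoc)

text \<open>P and Q are arbitrary representatives; only their classes are known to be homogeneous,
  so both are first exchanged for homogeneous ones. This freedom lets subgroups be pulled back to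
  all of \<open>\<P>\<close>.\<close>

lemma carrier_component_diff:
  assumes "P \<in> \<P>" "Q \<in> \<P>" "cl P \<in> carrier (\<Gamma> j)" "cl Q \<in> carrier (\<Gamma> j)"
  shows "cl (P - Q) \<in> carrier (\<Gamma> j)" "cl (P - Q) = cl P \<otimes>\<^bsub>\<Gamma> j\<^esub> inv\<^bsub>\<Gamma> j\<^esub> cl Q"
proof -
  obtain P' Q' where P': "P' \<in> homogeneous j" "cl P = cl P'" and Q': "Q' \<in> homogeneous j" "cl Q = cl Q'"
    using assms(3,4) by (auto simp: carrier_component)
  have "(P - Q) - (P' - Q') = (P - P') - (Q - Q')" by simp
  also have "\<dots> \<in> \<J>"
    using P' Q' assms(1,2) by (intro \<J>_diff[of "P - P'" "Q - Q'"]) (simp_all add: cl_eq_iff homogeneous_in_\<P>)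
  finally have "cl (P - Q) = cl (P' - Q')"
    using P' Q' assms(1,2) by (subst cl_eq_iff) (auto simp: homogeneous_in_\<P>)
  then show closed: "cl (P - Q) \<in> carrier (\<Gamma> j)"
    using homogeneous_diff[OF P'(1) Q'(1)] by (auto simp: carrier_component)
  have "cl (P - Q) \<otimes>\<^bsub>\<Gamma> j\<^esub> cl Q = cl P"
    using assms(1,2) by (subst mult_component) auto
  then show "cl (P - Q) = cl P \<otimes>\<^bsub>\<Gamma> j\<^esub> inv\<^bsub>\<Gamma> j\<^esub> cl Q"
    using closed assms(3,4) by (metis \<Gamma>.inv_solve_right)
qed

text \<open>Moves statements about subgroups of a component to additive subgroups of polynomials,
  where minimality of spans applies.\<close>

lemma subspace_subgroup:
  assumes "subgroup H (\<Gamma> j)"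
  shows "zmod.subspace {P \<in> \<P>. cl P \<in> H}"
proof (rule zmod_subspaceI)
  show "0 \<in> {P \<in> \<P>. cl P \<in> H}"
    using subgroup.one_closed[OF assms] by (simp add: one_component)
  fix P Q assume "P \<in> {P \<in> \<P>. cl P \<in> H}" "Q \<in> {P \<in> \<P>. cl P \<in> H}"
  then show "P - Q \<in> {P \<in> \<P>. cl P \<in> H}"
    using carrier_component_diff(2)[of P Q j] subgroup.mem_carrier[OF assms]
    by (auto simp: subgroup.m_closed[OF assms] subgroup.m_inv_closed[OF assms])
qed

lemma subgroup_contains_\<J>:
  assumes "subgroup H (\<Gamma> j)" "P \<in> \<J>"
  shows "cl P \<in> H"
proof -
  have "cl P = cl 0" using assms(2) \<J>_subset by (subst cl_eq_iff) auto
  then show ?thesis using subgroup.one_closed[OF assms(1)] by (simp add: one_component)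
qed

lemma mult_algebra: "P \<in> \<P> \<Longrightarrow> Q \<in> \<P> \<Longrightarrow> cl P \<otimes>\<^bsub>dp_algebra M\<^esub> cl Q = cl (P * Q)"
  using \<J>.rcoset_mult_add[of P Q] by (simp add: dp_algebra_def FactRing_def \<R>_simps)

lemma minus_algebra:
  assumes "P \<in> \<P>" "Q \<in> \<P>"
  shows "cl P \<ominus>\<^bsub>dp_algebra M\<^esub> cl Q = cl (P - Q)"
proof -
  interpret A: ring "dp_algebra M"
    unfolding dp_algebra_def by (rule \<J>.quotient_is_ring)
  have add: "cl S \<oplus>\<^bsub>dp_algebra M\<^esub> cl T = cl (S + T)" if "S \<in> \<P>" "T \<in> \<P>" for S T
    using mult_component[OF that] by (simp add: dp_component_def)
  have closed: "cl S \<in> carrier (dp_algebra M)" if "S \<in> \<P>" for S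
    using that by (auto simp: dp_algebra_def FactRing_def A_RCOSETS_def')
  have "\<zero>\<^bsub>dp_algebra M\<^esub> = cl 0"
    using one_component by (simp add: dp_component_def)
  then have "\<ominus>\<^bsub>dp_algebra M\<^esub> cl Q = cl (- Q)"
    using assms(2) \<P>_uminus[OF assms(2)] by (intro A.minus_equality) (simp_all add: add closed)
  then show ?thesis using assms \<P>_uminus[OF assms(2)] by (simp add: a_minus_def add)
qed

lemma symbol_1_add:
  assumes "x \<in> carrier M" "y \<in> carrier M"
  shows "poly_var (x \<oplus> y, 1) - (poly_var (x, 1) + poly_var (y, 1)) \<in> \<J>"
proof -
  have "poly_var (x \<oplus> y, 1) - (poly_var (x, 0) * poly_var (y, 1) + poly_var (x, 1) * poly_var (y, 0)) \<in> \<J>"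
    using symbol_add[OF assms, of 1] by (simp add: atMost_Suc numeral_2_eq_2 add.commute)
  moreover have "(poly_var (x, 0) * poly_var (y, 1) - 1 * poly_var (y, 1)) +
      (poly_var (x, 1) * poly_var (y, 0) - poly_var (x, 1) * 1) \<in> \<J>"
    using assms by (intro \<J>_add \<J>_mult_cong symbol_0) auto
  ultimately have "(poly_var (x \<oplus> y, 1) - (poly_var (x, 0) * poly_var (y, 1) + poly_var (x, 1) * poly_var (y, 0)))
      + ((poly_var (x, 0) * poly_var (y, 1) - 1 * poly_var (y, 1)) +
      (poly_var (x, 1) * poly_var (y, 0) - poly_var (x, 1) * 1)) \<in> \<J>"
    by (rule \<J>_add)
  then show ?thesis by (simp add: algebra_simps)
qed

text \<open>The two end terms of the sum formula are \<open>[y]_p\<close> and \<open>[x]_p\<close>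
  up to a factor \<open>[.]_0\<close>. In every other term both indices lie strictly between 0 and
  p, so \<open>symbol_in_linear_span\<close> applies to both factors.\<close>

lemma symbol_p_add:
  assumes p: "prime p" and torsion: "\<And>x. x \<in> carrier M \<Longrightarrow> [int (p ^ m)] \<cdot> x = \<zero>"
    and x: "x \<in> carrier M" and y: "y \<in> carrier M"
  shows "poly_var (x \<oplus> y, p) - (poly_var (x, p) + poly_var (y, p)) \<in> linear_span p"
proof -
  let ?t = "\<lambda>i. poly_var (x, i) * poly_var (y, p - i)"
  have "{..p} = insert 0 (insert p {0<..<p})" using prime_gt_0_nat[OF p] by auto
  then have sum: "sum ?t {..p} = ?t 0 + (?t p + sum ?t {0<..<p})"
    using prime_gt_0_nat[OF p] by (simp only:) (subst sum.insert; simp)+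
  define S where "S = sum ?t {0<..<p}"
  have "?t i \<in> linear_span p" if "i \<in> {0<..<p}" for i
  proof -
    have "?t i \<in> linear_span (i + (p - i))"
      using that by (intro linear_span_mult symbol_in_linear_span[OF p _ torsion] x y) auto
    then show ?thesis using that by simp
  qed
  then have span: "S \<in> linear_span p"
    unfolding S_def linear_span_def by (rule zmod.span_sum)
  have t0: "?t 0 - 1 * poly_var (y, p) \<in> \<J>"
    unfolding diff_zero by (rule \<J>_mult_cong[OF symbol_0[OF x]]) (simp_all add: y)
  have tp: "?t p - poly_var (x, p) * 1 \<in> \<J>"
    unfolding diff_self_eq_0 by (rule \<J>_mult_cong[OF _ symbol_0[OF y]]) (simp_all add: x y)
  have "(poly_var (x \<oplus> y, p) - (?t 0 + (?t p + S))) + ((?t 0 - 1 * poly_var (y, p)) + (?t p - poly_var (x, p) * 1)) \<in> \<J>"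
    using symbol_add[OF x y, of p, unfolded sum] unfolding S_def by (intro \<J>_add t0 tp)
  also have "(poly_var (x \<oplus> y, p) - (?t 0 + (?t p + S))) + ((?t 0 - 1 * poly_var (y, p)) + (?t p - poly_var (x, p) * 1))
      = poly_var (x \<oplus> y, p) - (poly_var (x, p) + poly_var (y, p)) - S"
    by (simp only: algebra_simps) simp
  finally show ?thesis by (rule linear_span_cong[OF _ span])
qed

end


section \<open>The power map\<close>

text \<open>Both structures are quotients of one ring type, by p^m and by p^(m+1).
  \<open>torsion_free\<close> makes multiplication by p from the first to the second injective.
  \<open>dvd_power_p\<close> and \<open>p_root\<close> say that the Frobenius of the ring modulo p
  is injective and surjective; they serve the kernel and the image of the power map
  respectively.\<close>

locale power_law =
  M: ring_modulo "of_nat p ^ m :: 'a::comm_ring_1" M c + N: ring_modulo "of_nat p ^ Suc m :: 'a" N d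
  for p m :: nat and M :: "('b, 'e) ring_scheme" (structure) and c and N :: "('f, 'g) ring_scheme" and d +
  assumes prime: "prime p" and m: "m > 0"
    and torsion_free: "of_nat p * a = (0 :: 'a) \<Longrightarrow> a = 0"
    and dvd_power_p: "of_nat p dvd a ^ p \<Longrightarrow> of_nat p dvd (a :: 'a)"
    and p_root: "\<exists>b e. (a :: 'a) = b ^ p + of_nat p * e"
begin

sublocale dp M
  by (rule dp.intro) (rule M.cring)

section \<open>Existence and uniqueness of the power map\<close>

definition is_power_hom :: "(('b \<times> nat) int_poly set \<Rightarrow> 'f) \<Rightarrow> bool" where
  "is_power_hom T \<longleftrightarrow> T \<in> hom (\<Gamma> p) (add_monoid N) \<and> T \<in> extensional (carrier (\<Gamma> p))
     \<and> (\<forall>a. T (dp_symbol M (c a) p) = d (a ^ p))"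

text \<open>An arbitrary choice of lifts, compatible with addition only modulo p^m.\<close>

definition rep :: "'b \<Rightarrow> 'a" where "rep x = (SOME a. c a = x)"

lemma c_rep: "x \<in> carrier M \<Longrightarrow> c (rep x) = x"
  unfolding rep_def by (rule someI_ex) (auto simp: M.carrier_eq)

lemma rep_cong: "of_nat p ^ m dvd rep (c a) - a"
  using c_rep[of "c a"] by (simp add: M.cls_eq_iff)

lemma torsion: "x \<in> carrier M \<Longrightarrow> [int (p ^ m)] \<cdot> x = \<zero>"
  by (auto simp: M.carrier_eq M.cls_int_mult M.zero_eq M.cls_eq_iff)

text \<open>
  With rational coefficients the ring homomorphism \<open>[x]\<^sub>i \<mapsto> x\<^sup>i / i!\<close> multiplied by \<open>p!\<close>
  would give the power map in degree \<open>p\<close>. Divided power sequences avoid the denominators.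
\<close>

definition law :: "('b \<times> nat) int_poly \<Rightarrow> 'a" where
  "law P = hcoeff (poly_eval (\<lambda>v. dpow (rep (fst v)) (snd v)) P) p"

lemma law_diff [simp]: "law (P - Q) = law P - law Q" and law_add [simp]: "law (P + Q) = law P + law Q"
  and law_0 [simp]: "law 0 = 0"
  by (simp_all add: law_def)

text \<open>The missing factor p comes from the binomial coefficient if 0 < n < p, and from the p-th
  power if n = p.\<close>

lemma binomial_power_cong:
  assumes "of_nat p ^ m dvd a - (b :: 'a)" "n \<le> p"
  shows "of_nat p ^ Suc m dvd of_nat (p choose n) * (a ^ n - b ^ n)"
proof -
  consider "n = 0" | "0 < n" "n < p" | "n = p" using assms(2) by linarith
  then show ?thesis
  proof cases
    case 2
    then have "p dvd p choose n" using prime by (intro dvd_choose_prime) auto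
    then have "(of_nat p :: 'a) dvd of_nat (p choose n)" by (auto elim!: dvdE)
    moreover have "of_nat p ^ m dvd a ^ n - b ^ n" using assms(1) dvd_power_diff by (rule dvd_trans)
    ultimately show ?thesis unfolding power_Suc by (rule mult_dvd_mono)
  next
    case 3
    then show ?thesis using power_p_cong[OF assms(1) m] by (simp only: binomial_n_n) simp
  qed simp
qed

text \<open>\<open>law\<close> is additive but not multiplicative, so the relations are placed in
  the ideal \<open>K\<close> of those polynomials all of whose multiples have \<open>law\<close>
  divisible by p^(m+1). The evaluation of a relation is either zero or
  \<open>dpow a n - dpow b n\<close> with a and b congruent modulo p^m; after multiplication by h
  its p-th coefficient is binom(p,n) (a^n - b^n) h_(p-n).\<close>

lemma law_\<J>:
  assumes "P \<in> \<J>"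
  shows "of_nat p ^ Suc m dvd law P"
proof -
  let ?\<phi> = "poly_eval (\<lambda>v. dpow (rep (fst v)) (snd v))"
  define K where "K = {P \<in> \<P>. \<forall>Q\<in>\<P>. of_nat p ^ Suc m dvd law (P * Q)}"
  have "ideal K \<R>"
  proof (rule ideal_\<R>I)
    show "P - Q \<in> K" if "P \<in> K" "Q \<in> K" for P Q
      using that unfolding K_def by (auto simp: left_diff_distrib simp del: power_Suc intro: dvd_diff)
    show "P * Q \<in> K" if P: "P \<in> \<P>" and Q: "Q \<in> K" for P Q
    proof -
      have "of_nat p ^ Suc m dvd law (P * Q * S)" if "S \<in> \<P>" for S
      proof -
        have "P * S \<in> \<P>" using P that by (rule \<P>_mult)
        then have "of_nat p ^ Suc m dvd law (Q * (P * S))" using Q by (simp only: K_def mem_Collect_eq)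
        moreover have "P * Q * S = Q * (P * S)" by (simp add: mult_ac)
        ultimately show ?thesis by (simp only:)
      qed
      moreover have "P * Q \<in> \<P>" using P Q by (simp only: K_def mem_Collect_eq \<P>_mult)
      ultimately show ?thesis by (simp only: K_def mem_Collect_eq) simp
    qed
  qed (auto simp: K_def)
  moreover have "dp_relations M \<subseteq> K"
  proof
    fix r assume r: "r \<in> dp_relations M"
    have "of_nat p ^ Suc m dvd hcoeff (?\<phi> r * h) p" for h
    proof -
      have pow: "of_nat p ^ Suc m dvd hcoeff ((dpow a n - dpow b n) * h) p"
        if "of_nat p ^ m dvd a - b" for a b n
      proof (cases "n \<le> p")
        case True
        have "hcoeff ((dpow a n - dpow b n) * h) p = of_nat (p choose n) * (a ^ n - b ^ n) * hcoeff h (p - n)"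
          unfolding left_diff_distrib right_diff_distrib hcoeff_simps hcoeff_dpow_mult
          using True by (simp only: if_True mult.assoc)
        then show ?thesis using dvd_mult2[OF binomial_power_cong[OF that True]] by (simp only:)
      qed (simp add: left_diff_distrib hcoeff_dpow_mult)
      from r consider
        (zero) x where "x \<in> carrier M" "r = poly_var (x, 0) - 1"
        | (add) x y n where "x \<in> carrier M" "y \<in> carrier M"
            "r = poly_var (x \<oplus> y, n) - (\<Sum>i\<le>n. poly_var (x, i) * poly_var (y, n - i))"
        | (smult) l x n where "x \<in> carrier M"
            "r = poly_var ([(l::int)] \<cdot> x, n) - of_int (l ^ n) * poly_var (x, n)"
        | (mult) x n k where "x \<in> carrier M"
            "r = poly_var (x, n) * poly_var (x, k) - of_nat ((n + k) choose n) * poly_var (x, n + k)"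
        unfolding dp_relations_def by - (elim UnE CollectE exE conjE; (rule that; assumption))
      then show ?thesis
      proof cases
        case zero
        then have "?\<phi> r = 0" by (simp add: dpow_0)
        then show ?thesis by simp
      next
        case add
        have "c (rep (x \<oplus> y)) = c (rep x + rep y)"
          using add by (simp add: c_rep flip: M.cls_add)
        then have "of_nat p ^ m dvd rep (x \<oplus> y) - (rep x + rep y)" by (simp only: M.cls_eq_iff)
        moreover have "?\<phi> r = dpow (rep (x \<oplus> y)) n - dpow (rep x + rep y) n"
          using add by (simp add: dpow_add)
        ultimately show ?thesis using pow by (simp only:)
      next
        case smult
        have "c (rep ([l] \<cdot> x)) = [l] \<cdot> c (rep x)"
          using smult by (simp add: c_rep)
        then have "of_nat p ^ m dvd rep ([l] \<cdot> x) - of_int l * rep x"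
          by (simp only: M.cls_int_mult M.cls_eq_iff)
        moreover have "?\<phi> r = dpow (rep ([l] \<cdot> x)) n - dpow (of_int l * rep x) n"
          unfolding smult(2) dpow_of_int_mult poly_eval_diff poly_eval_mult poly_eval_of_int poly_eval_var
          by simp
        ultimately show ?thesis using pow by (simp only:)
      next
        case mult
        then have "?\<phi> r = 0" by (simp add: dpow_mult)
        then show ?thesis by simp
      qed
    qed
    then show "r \<in> K"
      using subsetD[OF relations_subset r] by (simp only: K_def law_def poly_eval_mult mem_Collect_eq) simp
  qed
  ultimately have "\<J> \<subseteq> K"
    unfolding dp_ideal_def by (rule \<R>.genideal_minimal)
  then have "P \<in> K" using assms by (rule subsetD)
  then have "of_nat p ^ Suc m dvd law (P * 1)" unfolding K_def using \<P>_1 by (simp only: mem_Collect_eq)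
  then show ?thesis by simp
qed

lemma d_law_eq:
  assumes "P \<in> \<P>" "Q \<in> \<P>" "cl P = cl Q"
  shows "d (law P) = d (law Q)"
  using assms law_\<J>[of "P - Q"] by (simp add: cl_eq_iff N.cls_eq_iff del: power_Suc)

definition power_hom :: "('b \<times> nat) int_poly set \<Rightarrow> 'f" where
  "power_hom = restrict (\<lambda>z. d (law (SOME P. P \<in> \<P> \<and> cl P = z))) (carrier (\<Gamma> p))"

lemma power_hom_cl:
  assumes "P \<in> \<P>" "cl P \<in> carrier (\<Gamma> p)"
  shows "power_hom (cl P) = d (law P)"
proof -
  let ?Q = "SOME Q. Q \<in> \<P> \<and> cl Q = cl P"
  have "?Q \<in> \<P> \<and> cl ?Q = cl P"
    using assms by (intro someI[of "\<lambda>Q. Q \<in> \<P> \<and> cl Q = cl P" P]) simp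
  then have "d (law ?Q) = d (law P)" using assms by (intro d_law_eq) auto
  with assms show ?thesis by (simp add: power_hom_def)
qed

lemma law_symbol_p: "of_nat p ^ Suc m dvd law (poly_var (c a, p)) - a ^ p"
  using power_p_cong[OF rep_cong m, of a] by (simp add: law_def)

text \<open>The product of t^[1] and t^[p-1] is p t^[p]. This factor p raises the congruence of the
  lifts from modulus p^m to p^(m+1).\<close>

lemma law_symbol_1_mult:
  "of_nat p ^ Suc m dvd law (poly_var (c a, 1) * poly_var (c b, p - 1)) - of_nat p * (a * b ^ (p - 1))"
proof -
  let ?a = "rep (c a)" and ?b = "rep (c b)"
  have "law (poly_var (c a, 1) * poly_var (c b, p - 1)) = of_nat p * (?a * ?b ^ (p - 1))"
    using prime_gt_0_nat[OF prime] by (simp add: law_def hcoeff_dpow_mult)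
  moreover have "of_nat p ^ m dvd ?a * (?b ^ (p - 1) - b ^ (p - 1)) + (?a - a) * b ^ (p - 1)"
    using rep_cong[of a] dvd_trans[OF rep_cong dvd_power_diff[of ?b b "p - 1"]]
    by (intro dvd_add dvd_mult dvd_mult2)
  then have "of_nat p * of_nat p ^ m dvd of_nat p * (?a * ?b ^ (p - 1) - a * b ^ (p - 1))"
    by (intro mult_dvd_mono dvd_refl) (simp add: algebra_simps)
  ultimately show ?thesis by (simp add: right_diff_distrib)
qed

lemma is_power_hom_power_hom: "is_power_hom power_hom"
  unfolding is_power_hom_def
proof (intro conjI allI)
  show "power_hom \<in> hom (\<Gamma> p) (add_monoid N)"
  proof (rule homI)
    fix y z assume "y \<in> carrier (\<Gamma> p)" "z \<in> carrier (\<Gamma> p)"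
    moreover from this obtain P Q where "P \<in> homogeneous p" "y = cl P" "Q \<in> homogeneous p" "z = cl Q"
      by (auto simp: carrier_component)
    moreover from this have "P + Q \<in> homogeneous p" by (blast intro: homogeneous_closed)
    ultimately show "power_hom (y \<otimes>\<^bsub>\<Gamma> p\<^esub> z) = power_hom y \<otimes>\<^bsub>add_monoid N\<^esub> power_hom z"
      by (simp add: mult_component power_hom_cl homogeneous_in_\<P> carrier_component N.cls_add)
  qed (auto simp: carrier_component power_hom_cl homogeneous_in_\<P>)
  show "power_hom \<in> extensional (carrier (\<Gamma> p))" by (simp add: power_hom_def)
  fix a
  show "power_hom (dp_symbol M (c a) p) = d (a ^ p)"
    using law_symbol_p[of a]
    by (simp add: dp_symbol_def power_hom_cl carrier_component homogeneous_var N.cls_eq_iff del: power_Suc)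
qed

lemma group_hom_power_hom: "is_power_hom T \<Longrightarrow> group_hom (\<Gamma> p) (add_monoid N) T"
  by (rule group_hom.intro) (auto simp: group_hom_axioms_def is_power_hom_def N.a_group \<Gamma>.is_group)

text \<open>The set where both maps agree is a subgroup whose preimage contains \<open>\<J>\<close>
  and all \<open>[x]_p\<close>, hence \<open>powers_span p\<close> and with it every homogeneous
  polynomial of degree p.\<close>

lemma is_power_hom_unique:
  assumes S: "is_power_hom S" and T: "is_power_hom T"
  shows "S = T"
proof (rule extensionalityI)
  show "S \<in> extensional (carrier (\<Gamma> p))" "T \<in> extensional (carrier (\<Gamma> p))"
    using S T by (auto simp: is_power_hom_def)
  fix z assume "z \<in> carrier (\<Gamma> p)"
  then obtain P where P: "P \<in> homogeneous p" "z = cl P" by (auto simp: carrier_component)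
  interpret S: group_hom "\<Gamma> p" "add_monoid N" S by (rule group_hom_power_hom[OF S])
  interpret T: group_hom "\<Gamma> p" "add_monoid N" T by (rule group_hom_power_hom[OF T])
  let ?H = "{z \<in> carrier (\<Gamma> p). S z = T z}"
  have H: "subgroup ?H (\<Gamma> p)"
    by (rule \<Gamma>.subgroupI) auto
  have "P \<in> powers_span p"
    using P(1) homogeneous_subset_powers_span[OF prime torsion] by blast
  also have "\<dots> \<subseteq> {P \<in> \<P>. cl P \<in> ?H}"
    unfolding powers_span_def
  proof (intro zmod.span_minimal subspace_subgroup[OF H] Un_least subsetI)
    fix Q assume "Q \<in> {poly_var (x, p) | x. x \<in> carrier M}"
    then obtain a where Q: "Q = poly_var (c a, p)" by (auto simp: M.carrier_eq)
    then have "Q \<in> homogeneous p" by (simp add: homogeneous_var)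
    then show "Q \<in> {P \<in> \<P>. cl P \<in> ?H}"
      using S T unfolding is_power_hom_def dp_symbol_def
      by (simp add: Q carrier_component homogeneous_in_\<P>)
  qed (use \<J>_subset subgroup_contains_\<J>[OF H] in auto)
  finally show "S z = T z" by (simp add: P)
qed

section \<open>The kernel and the image of the power map\<close>

definition \<psi> :: "'a \<Rightarrow> ('b \<times> nat) int_poly" where
  "\<psi> b = poly_var (c b, 1) * poly_var (\<one>, p - 1)"

definition kernel_relations :: "('b \<times> nat) int_poly set set" where
  "kernel_relations = {cl (poly_var (c a, 1) * poly_var (c b, p - 1) - \<psi> (a * b ^ (p - 1))) | a b. True}"

lemma homogeneous_1_mult: "poly_var (c a, 1) * poly_var (c b, p - 1) \<in> homogeneous p"
  using homogeneous_mult[OF homogeneous_var[of "c a" 1] homogeneous_var[of "c b" "p - 1"]]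
    prime_gt_0_nat[OF prime] by simp

lemma \<psi>_homogeneous: "\<psi> b \<in> homogeneous p"
  unfolding \<psi>_def M.one_eq by (rule homogeneous_1_mult)

lemma law_\<psi>: "of_nat p ^ Suc m dvd law (\<psi> b) - of_nat p * b"
  using law_symbol_1_mult[of b 1] by (simp add: \<psi>_def M.one_eq)

lemma kernel_relations_subset: "kernel_relations \<subseteq> kernel (\<Gamma> p) (add_monoid N) power_hom"
proof
  fix z assume "z \<in> kernel_relations"
  then obtain a b where z: "z = cl (poly_var (c a, 1) * poly_var (c b, p - 1) - \<psi> (a * b ^ (p - 1)))" (is "z = cl ?r")
    by (auto simp: kernel_relations_def)
  have r: "?r \<in> homogeneous p"
    by (intro homogeneous_diff homogeneous_1_mult \<psi>_homogeneous)
  have "of_nat p ^ Suc m dvd law ?r"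
    using dvd_diff[OF law_symbol_1_mult[of a b] law_\<psi>[of "a * b ^ (p - 1)"]] by simp
  then have "d (law ?r) = \<zero>\<^bsub>N\<^esub>" by (simp add: N.zero_eq N.cls_eq_iff del: power_Suc)
  then show "z \<in> kernel (\<Gamma> p) (add_monoid N) power_hom"
    using r by (simp add: kernel_def z power_hom_cl homogeneous_in_\<P> carrier_component)
qed

lemma subgroup_kernel: "subgroup (kernel (\<Gamma> p) (add_monoid N) power_hom) (\<Gamma> p)"
  by (rule group_hom.subgroup_kernel[OF group_hom_power_hom[OF is_power_hom_power_hom]])

lemma kernel_relations_carrier: "kernel_relations \<subseteq> carrier (\<Gamma> p)"
  using kernel_relations_subset by (auto simp: kernel_def)

lemma \<psi>_diff: "\<psi> a - \<psi> b - \<psi> (a - b) \<in> \<J>"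
proof -
  have "(poly_var (c b \<oplus> c (a - b), 1) - (poly_var (c b, 1) + poly_var (c (a - b), 1))) * poly_var (\<one>, p - 1) \<in> \<J>"
    by (intro \<J>_mult symbol_1_add) (simp_all add: M.one_eq)
  then show ?thesis by (simp add: \<psi>_def M.cls_add algebra_simps)
qed

text \<open>
  Modulo the relations every element of \<open>\<Gamma>\<^sup>p\<close> has the form \<open>[x]\<^sub>p + [w]\<^sub>1[1]\<^sub>p\<^sub>-\<^sub>1\<close>. If it
  is in the kernel then \<open>p\<close> divides \<open>x\<close>, so that \<open>[x]\<^sub>p\<close> may be absorbed into the second term,
  on which the power map is injective.
\<close>

definition relation_polys :: "('b \<times> nat) int_poly set" where
  "relation_polys = {P \<in> \<P>. cl P \<in> generate (\<Gamma> p) kernel_relations}"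

definition shift_polys :: "('b \<times> nat) int_poly set" where
  "shift_polys = {P \<in> \<P>. \<exists>b. P - \<psi> b \<in> relation_polys}"

lemma subgroup_generate: "subgroup (generate (\<Gamma> p) kernel_relations) (\<Gamma> p)"
  by (rule \<Gamma>.generate_is_subgroup[OF kernel_relations_carrier])

lemma subspace_relation_polys: "zmod.subspace relation_polys"
  unfolding relation_polys_def by (rule subspace_subgroup[OF subgroup_generate])

lemma \<J>_relation_polys: "P \<in> \<J> \<Longrightarrow> P \<in> relation_polys"
  using \<J>_subset subgroup_contains_\<J>[OF subgroup_generate] by (auto simp: relation_polys_def)

lemma law_relation_polys:
  assumes "P \<in> relation_polys"
  shows "of_nat p ^ Suc m dvd law P"
proof -
  have "generate (\<Gamma> p) kernel_relations \<subseteq> kernel (\<Gamma> p) (add_monoid N) power_hom"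
    by (rule \<Gamma>.generate_subgroup_incl[OF kernel_relations_subset subgroup_kernel])
  then have "d (law P) = \<zero>\<^bsub>N\<^esub>"
    using assms by (auto simp: relation_polys_def kernel_def power_hom_cl)
  then show ?thesis by (simp add: N.zero_eq N.cls_eq_iff)
qed

lemma \<psi>_in_\<P>: "\<psi> b \<in> \<P>"
  by (rule homogeneous_in_\<P>[OF \<psi>_homogeneous])

lemma \<psi>_0: "\<psi> 0 \<in> \<J>"
  unfolding \<psi>_def M.zero_eq[symmetric] M.one_eq by (intro \<J>_mult symbol_zero) simp_all

lemma relation_shift_polys: "P \<in> relation_polys \<Longrightarrow> P \<in> shift_polys"
  unfolding shift_polys_def
  using zmod.subspace_diff[OF subspace_relation_polys _ \<J>_relation_polys[OF \<psi>_0]]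
  by (auto simp: relation_polys_def)

lemma subspace_shift_polys: "zmod.subspace shift_polys"
proof (rule zmod_subspaceI)
  show "0 \<in> shift_polys" by (intro relation_shift_polys \<J>_relation_polys) simp
  fix P Q assume "P \<in> shift_polys" "Q \<in> shift_polys"
  then obtain a b where PQ: "P \<in> \<P>" "Q \<in> \<P>" "P - \<psi> a \<in> relation_polys" "Q - \<psi> b \<in> relation_polys"
    by (auto simp: shift_polys_def)
  from zmod.subspace_add[OF subspace_relation_polys zmod.subspace_diff[OF subspace_relation_polys PQ(3,4)]
      \<J>_relation_polys[OF \<psi>_diff[of a b]]]
have "P - Q - \<psi> (a - b) \<in> relation_polys" by (simp add: algebra_simps)
  then show "P - Q \<in> shift_polys" using PQ by (auto simp: shift_polys_def)
qed

lemma symbol_1_mult_shift_polys: "poly_var (c a, 1) * poly_var (c b, p - 1) \<in> shift_polys"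
proof -
  let ?P = "poly_var (c a, 1) * poly_var (c b, p - 1)"
  have "cl (?P - \<psi> (a * b ^ (p - 1))) \<in> generate (\<Gamma> p) kernel_relations"
    by (rule generate.incl) (auto simp: kernel_relations_def)
  moreover have "?P \<in> \<P>" by auto
  ultimately show ?thesis
    using \<psi>_in_\<P> by (auto simp: shift_polys_def relation_polys_def)
qed

text \<open>One factor \<open>[x]_1\<close> is split off and the remaining p - 1 factors are
  polarized into combinations of \<open>[y]_(p-1)\<close>, which is possible as p - 1 > 0. Each
  product \<open>[x]_1 [y]_(p-1)\<close> is then rewritten by one relation.\<close>

lemma linear_span_shift_polys: "linear_span p \<subseteq> shift_polys"
  unfolding linear_span_def
proof (intro zmod.span_minimal subspace_shift_polys Un_least subsetI)
  fix P assume "P \<in> linear_products p"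
  then obtain xs where xs: "P = prod_list (map (\<lambda>x. poly_var (x, 1)) xs)" "set xs \<subseteq> carrier M" "length xs = p"
    by (auto simp: linear_products_def)
  have p: "p > 1" using prime by (rule prime_gt_1_nat)
  with xs(3) obtain x ys where "xs = x # ys" by (cases xs) auto
  with xs obtain a where ys: "P = poly_var (c a, 1) * prod_list (map (\<lambda>x. poly_var (x, 1)) ys)"
      "set ys \<subseteq> carrier M" "length ys = p - 1"
    by (auto simp: M.carrier_eq)
  then have "prod_list (map (\<lambda>x. poly_var (x, 1)) ys) \<in> linear_products (p - 1)"
    unfolding linear_products_def by blast
  then have "prod_list (map (\<lambda>x. poly_var (x, 1)) ys) \<in> powers_span (p - 1)"
    using linear_products_subset_powers_span[of "p - 1"] p by auto
  then have "poly_var (c a, 1) * prod_list (map (\<lambda>x. poly_var (x, 1)) ys) \<in> shift_polys"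
    unfolding powers_span_def
  proof (induction rule: zmod.span_induct)
    case base
    show ?case
      by (rule zmod_subspaceI)
        (simp_all add: right_diff_distrib zmod.subspace_0[OF subspace_shift_polys] zmod.subspace_diff[OF subspace_shift_polys])
  next
    case (step Q)
    then show ?case
    proof
      assume "Q \<in> \<J>"
      then show ?thesis by (intro relation_shift_polys \<J>_relation_polys \<J>_mult) simp_all
    next
      assume "Q \<in> {poly_var (x, p - 1) | x. x \<in> carrier M}"
      then show ?thesis using symbol_1_mult_shift_polys by (auto simp: M.carrier_eq)
    qed
  qed
  then show "P \<in> shift_polys" by (simp add: ys)
qed (intro relation_shift_polys \<J>_relation_polys)

lemma homogeneous_decomposition:
  assumes "P \<in> homogeneous p"
  shows "\<exists>a. P - poly_var (c a, p) \<in> shift_polys"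
proof -
  let ?E = "{P. \<exists>a. P - poly_var (c a, p) \<in> shift_polys}"
  have p0: "p > 0" using prime by (rule prime_gt_0_nat)
  have zero: "poly_var (c 0, p) \<in> shift_polys"
    using symbol_zero[OF p0] by (simp add: M.zero_eq relation_shift_polys \<J>_relation_polys)
  have "P \<in> ?E"
  proof (rule homogeneous_in_subspace[OF prime torsion _ _ _ assms])
    show "zmod.subspace ?E"
    proof (rule zmod_subspaceI)
      show "0 \<in> ?E"
        using zmod.subspace_neg[OF subspace_shift_polys zero] by auto
      fix P Q assume "P \<in> ?E" "Q \<in> ?E"
      then obtain a b where ab: "P - poly_var (c a, p) \<in> shift_polys" "Q - poly_var (c b, p) \<in> shift_polys"
        by auto
      \<comment> \<open>Additivity for b and a - b shows that \<open>[a]_p - [b]_p\<close> may be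
        replaced by \<open>[a - b]_p\<close>, which gives closure under differences.\<close>
      have "poly_var (c b \<oplus> c (a - b), p) - (poly_var (c b, p) + poly_var (c (a - b), p)) \<in> shift_polys"
        by (intro subsetD[OF linear_span_shift_polys] symbol_p_add[OF prime torsion]) simp_all
      then have "poly_var (c a, p) - (poly_var (c b, p) + poly_var (c (a - b), p)) \<in> shift_polys"
        by (simp add: M.cls_add)
      from zmod.subspace_add[OF subspace_shift_polys zmod.subspace_diff[OF subspace_shift_polys ab] this]
      have "P - Q - poly_var (c (a - b), p) \<in> shift_polys" by (simp add: algebra_simps)
      then show "P - Q \<in> ?E" by blast
    qed
    show "linear_span p \<subseteq> ?E"
      using linear_span_shift_polys zmod.subspace_diff[OF subspace_shift_polys _ zero] by blast
    show "poly_var (x, p) \<in> ?E" if x: "x \<in> carrier M" for x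
    proof -
      obtain a where "x = c a" using x by (rule M.carrierE)
      then have "poly_var (x, p) - poly_var (c a, p) \<in> shift_polys"
        by (simp add: zmod.subspace_0[OF subspace_shift_polys])
      then show ?thesis by blast
    qed
  qed
  then show ?thesis by simp
qed

lemma symbol_p_multiple_shift_polys: "poly_var (c (of_nat p * a), p) \<in> shift_polys"
proof -
  let ?x = "poly_var (c a, p)"
  have p0: "p > 0" using prime by (rule prime_gt_0_nat)
  have "poly_var (c a, 1) * poly_var (c a, p - 1) - of_nat ((1 + (p - 1)) choose 1) * poly_var (c a, 1 + (p - 1)) \<in> \<J>"
    by (rule symbol_mult) simp
  then have "poly_var (c a, 1) * poly_var (c a, p - 1) - of_nat p * ?x \<in> shift_polys"
    using p0 by (intro relation_shift_polys \<J>_relation_polys) simp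
  from zmod.subspace_diff[OF subspace_shift_polys symbol_1_mult_shift_polys[of a a] this]
  have "of_nat p * ?x \<in> shift_polys" by simp
  \<comment> \<open>The scalar of the symbol of p a is p^p; one factor p has just been used to make
    \<open>?x\<close> a product of two symbols, and p^(p-1) remains.\<close>
  from zmod.subspace_scale[OF subspace_shift_polys this, of "int p ^ (p - 1)"]
  have "of_int (int p ^ (p - 1)) * (of_nat p * ?x) \<in> shift_polys" .
  also have "of_int (int p ^ (p - 1)) * (of_nat p * ?x) = of_int (int p ^ p) * ?x"
  proof -
    have "int p ^ p = int p ^ (p - 1) * int p" using p0 by (cases p) simp_all
    then show ?thesis by (simp add: mult.assoc)
  qed
  finally have "of_int (int p ^ p) * ?x \<in> shift_polys" .
  moreover have "poly_var ([int p] \<cdot> c a, p) - of_int (int p ^ p) * ?x \<in> shift_polys"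
    by (intro relation_shift_polys \<J>_relation_polys symbol_smult) simp
  ultimately have "poly_var ([int p] \<cdot> c a, p) - of_int (int p ^ p) * ?x + of_int (int p ^ p) * ?x \<in> shift_polys"
    by (rule zmod.subspace_add[OF subspace_shift_polys, rotated])
  then show ?thesis by (simp add: M.cls_int_mult)
qed

lemma kernel_power_hom: "kernel (\<Gamma> p) (add_monoid N) power_hom = generate (\<Gamma> p) kernel_relations"
proof
  show "generate (\<Gamma> p) kernel_relations \<subseteq> kernel (\<Gamma> p) (add_monoid N) power_hom"
    by (rule \<Gamma>.generate_subgroup_incl[OF kernel_relations_subset subgroup_kernel])
  show "kernel (\<Gamma> p) (add_monoid N) power_hom \<subseteq> generate (\<Gamma> p) kernel_relations"
  proof
    fix z assume z: "z \<in> kernel (\<Gamma> p) (add_monoid N) power_hom"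
    then obtain P where P: "P \<in> homogeneous p" "z = cl P" by (auto simp: kernel_def carrier_component)
    have "power_hom (cl P) = \<zero>\<^bsub>N\<^esub>" using z P by (simp add: kernel_def)
    then have "d (law P) = d 0"
      using P by (simp add: power_hom_cl homogeneous_in_\<P> carrier_component N.zero_eq)
    then have law_P: "of_nat p ^ Suc m dvd law P" by (simp add: N.cls_eq_iff del: power_Suc)
    obtain a where a: "P - poly_var (c a, p) \<in> shift_polys"
      using homogeneous_decomposition[OF P(1)] by blast
    then obtain b where b: "P - poly_var (c a, p) - \<psi> b \<in> relation_polys"
      by (auto simp: shift_polys_def)
    \<comment> \<open>The difference telescopes to a^p + p b, the value of the power map on the
      normal form of P, which is therefore zero modulo p^(m+1).\<close>
    have "of_nat p ^ Suc m dvd law P - (law P - law (poly_var (c a, p)) - law (\<psi> b))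
        - (law (poly_var (c a, p)) - a ^ p) - (law (\<psi> b) - of_nat p * b)"
      by (rule dvd_diff[OF dvd_diff[OF dvd_diff[OF law_P law_relation_polys[OF b, unfolded law_diff]] law_symbol_p] law_\<psi>])
    then have "of_nat p ^ Suc m dvd a ^ p + of_nat p * b" by simp
    then have "of_nat p dvd a ^ p + of_nat p * b" by (metis dvd_mult_left power_Suc)
    then have "of_nat p dvd a ^ p" by (metis dvd_add_left_iff dvd_triv_left)
    then obtain a' where "a = of_nat p * a'" using dvd_power_p by (auto elim: dvdE)
    then have "poly_var (c a, p) \<in> shift_polys" by (simp add: symbol_p_multiple_shift_polys)
    from zmod.subspace_add[OF subspace_shift_polys a this] have "P \<in> shift_polys" by simp
    then obtain b' where b': "P - \<psi> b' \<in> relation_polys" by (auto simp: shift_polys_def)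
    have "of_nat p ^ Suc m dvd law P - (law P - law (\<psi> b')) - (law (\<psi> b') - of_nat p * b')"
      by (rule dvd_diff[OF dvd_diff[OF law_P law_relation_polys[OF b', unfolded law_diff]] law_\<psi>])
    \<comment> \<open>Cancelling p leaves b' divisible by p^m, so the class of b' in M is zero and
      \<open>\<psi> b'\<close> lies in \<open>\<J>\<close>.\<close>
    then have "of_nat p ^ Suc m dvd of_nat p * b'" by simp
    then obtain e where "of_nat p * b' = of_nat p ^ Suc m * e" by (elim dvdE)
    then have "of_nat p * (b' - of_nat p ^ m * e) = 0" by (simp add: algebra_simps)
    then have "b' = of_nat p ^ m * e" using torsion_free by fastforce
    then have "c b' = c 0" by (simp add: M.cls_eq_iff)
    then have "\<psi> b' = \<psi> 0" by (simp add: \<psi>_def)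
    then have "\<psi> b' \<in> relation_polys" by (simp add: \<J>_relation_polys \<psi>_0)
    from zmod.subspace_add[OF subspace_relation_polys b' this] have "P \<in> relation_polys" by simp
    then show "z \<in> generate (\<Gamma> p) kernel_relations" by (simp add: relation_polys_def P)
  qed
qed

text \<open>A preimage of the class of a^p + p b is the class of \<open>[a]_p + \<psi> b\<close>,
  and \<open>p_root\<close> writes every element in this form.\<close>

lemma epi_power_hom: "power_hom \<in> epi (\<Gamma> p) (add_monoid N)"
  unfolding epi_def
proof (intro CollectI conjI)
  show hom: "power_hom \<in> hom (\<Gamma> p) (add_monoid N)"
    using is_power_hom_power_hom by (simp add: is_power_hom_def)
  show "power_hom ` carrier (\<Gamma> p) = carrier (add_monoid N)"
  proof
    show "power_hom ` carrier (\<Gamma> p) \<subseteq> carrier (add_monoid N)"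
      using hom by (auto simp: hom_def)
    show "carrier (add_monoid N) \<subseteq> power_hom ` carrier (\<Gamma> p)"
    proof
      fix y assume "y \<in> carrier (add_monoid N)"
      then obtain u where u: "y = d u" by (auto simp: N.carrier_eq)
      obtain a b where ab: "u = a ^ p + of_nat p * b" using p_root by blast
      let ?P = "poly_var (c a, p) + \<psi> b"
      have P: "?P \<in> homogeneous p"
        by (intro homogeneous_closed(2) homogeneous_var \<psi>_homogeneous) simp
      have "of_nat p ^ Suc m dvd (law (poly_var (c a, p)) - a ^ p) + (law (\<psi> b) - of_nat p * b)"
        by (intro dvd_add law_symbol_p law_\<psi>)
      then have "d (law ?P) = d u" by (simp add: N.cls_eq_iff ab algebra_simps)
      then have "power_hom (cl ?P) = y"
        using P by (simp add: power_hom_cl homogeneous_in_\<P> carrier_component u del: law_add)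
      moreover have "cl ?P \<in> carrier (\<Gamma> p)" using P by (auto simp: carrier_component)
      ultimately show "y \<in> power_hom ` carrier (\<Gamma> p)" by blast
    qed
  qed
qed

end

theorem proposition6p8:
  fixes p m :: nat
  assumes "prime p"
    and "CHAR('k::field) = p"
    and "surj (\<lambda>x::'k. x ^ p)"
    and "m > 0"
  shows "let W = (witt_quot p m :: (nat \<Rightarrow> 'k) set ring);
             W' = (witt_quot p (m + 1) :: (nat \<Rightarrow> 'k) set ring);
             T = power_map p m
         in is_power_map p m T \<and>
            T \<in> epi (dp_component W p) (add_monoid W') \<and>
            kernel (dp_component W p) (add_monoid W') T =
              generate (dp_component W p) (power_map_relations p m)"
proof -
  let ?W = "witt_quot p m :: (nat \<Rightarrow> 'k) set ring"
  interpret power_law p m ?W "witt_cls p m" "witt_quot p (Suc m)" "witt_cls p (Suc m) :: 'k witt \<Rightarrow> _"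
  proof (rule power_law.intro[OF ring_modulo_witt_quot[OF assms(1,2)] ring_modulo_witt_quot[OF assms(1,2)]],
      rule power_law_axioms.intro)
    show "prime p" "m > 0" by (rule assms)+
    fix a :: "'k witt"
    show "a = 0" if "of_nat p * a = 0" using that by (rule witt_p_torsion_free[OF assms(1,2)])
    show "of_nat p dvd a" if "of_nat p dvd a ^ p" using that by (rule witt_p_dvd_power[OF assms(1-3)])
    show "\<exists>b e. a = b ^ p + of_nat p * e" by (rule witt_p_root[OF assms(1-3)])
  qed
  \<comment> \<open>A pair x, X with X lifting x is precisely the pair of classes of one Witt vector
    a, so quantifying over such pairs amounts to quantifying over a.\<close>
  have iff: "is_power_map p m T \<longleftrightarrow> is_power_hom T" for T
  proof -
    have "(\<forall>x\<in>carrier ?W. \<forall>X\<in>carrier (witt_quot p (m + 1)). witt_lifts p (m + 1) m X x \<longrightarrow>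
          T (dp_symbol ?W x p) = X [^]\<^bsub>witt_quot p (m + 1)\<^esub> p)
      \<longleftrightarrow> (\<forall>a. T (dp_symbol ?W (witt_cls p m a) p) = witt_cls p (Suc m) (a ^ p))"
      unfolding witt_lifts_iff Suc_eq_plus1[symmetric] N.cls_pow[symmetric]
      using M.cls_closed N.cls_closed by blast
    then show ?thesis unfolding is_power_map_def is_power_hom_def by simp
  qed
  have is_map: "is_power_map p m power_hom"
    by (simp only: iff is_power_hom_power_hom)
  have map: "power_map p m = power_hom"
    unfolding power_map_def
    by (rule the_equality, rule is_map) (simp only: iff is_power_hom_unique is_power_hom_power_hom)
  have rel: "(dp_symbol ?W (witt_cls p m a) 1 \<otimes>\<^bsub>dp_algebra ?W\<^esub> dp_symbol ?W (witt_cls p m b) (p - 1))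
        \<ominus>\<^bsub>dp_algebra ?W\<^esub>
       (dp_symbol ?W (witt_cls p m a \<otimes>\<^bsub>?W\<^esub> (witt_cls p m b [^]\<^bsub>?W\<^esub> (p - 1))) 1
         \<otimes>\<^bsub>dp_algebra ?W\<^esub> dp_symbol ?W \<one>\<^bsub>?W\<^esub> (p - 1))
      = cl (poly_var (witt_cls p m a, 1) * poly_var (witt_cls p m b, p - 1) - \<psi> (a * b ^ (p - 1)))" for a b
    unfolding dp_symbol_def M.cls_pow M.cls_mult \<psi>_def
    by (subst mult_algebra, simp, simp, subst mult_algebra, simp, simp, subst minus_algebra) auto
  have "power_map_relations p m = kernel_relations"
    unfolding power_map_relations_def kernel_relations_def Let_def
    by (simp only: M.carrier_eq flip: rel) (auto simp only: image_iff)
  then show ?thesis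
    unfolding Let_def map
    using is_map epi_power_hom kernel_power_hom by simp
qed

end
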